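(* Let $\mathcal E\in C^2(\mathbb R^d)$ be positive with $\underline{\mathcal E}:=\inf\mathcal E$ and $\overline{\mathcal E}:=\sup\mathcal E$ finite, and suppose there are $c_1,c_2>0$ with $\sup_v|\nabla\mathcal E(v)|\le c_1$ and $\sup_v|\partial_{ii}\mathcal E(v)|\le c_2$ for all $i=1,\dots,d$. Let $\lambda,\sigma\ge0$, $\beta>0$, $C_{\beta,\mathcal E}:=e^{\beta(\overline{\mathcal E}-\underline{\mathcal E})}$, and let $f(v,t)$ be a (weak) solution of the mean-field equation described in the context with initial datum $f_0$. Suppose $$\mu:=\frac{\lambda}{C_{\beta,\mathcal E}}-2\sigma^2\kappa>0,\qquad \nu:=\frac{4(\lambda c_1+\sigma^2\kappa c_2)\beta e^{-\beta\underline{\mathcal E}}}{\mu\,\|\omega_\beta^{\mathcal E}\|_{L^1(f_0)}}V(0)^{1/2}<\frac12 .$$ Then there exists $\tilde v\in\mathbb R^d$ such that $m(t)\to\tilde v$ as $t\to\infty$, and $$\mathcal E(\tilde v)\le\underline{\mathcal E}+r(\beta)+\frac{\log2}{\beta},\qquad r(\beta):=-\frac1\beta\log\|\omega_\beta^{\mathcal E}\|_{L^1(f_0)}-\underline{\mathcal E}.$$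
   Context: $\omega_\beta^{\mathcal E}(v):=e^{-\beta\mathcal E(v)}$, $\|\omega_\beta^{\mathcal E}\|_{L^1(g)}:=\int\omega_\beta^{\mathcal E}(v)g(v)\,dv$, $\gamma_\beta^{\mathcal E}(v,v_* ):=\frac{\omega_\beta^{\mathcal E}(v_* )}{\omega_\beta^{\mathcal E}(v)+\omega_\beta^{\mathcal E}(v_* )}$, $v_{\beta,\mathcal E}(v,v_* ):=\frac{\omega_\beta^{\mathcal E}(v)v+\omega_\beta^{\mathcal E}(v_* )v_*}{\omega_\beta^{\mathcal E}(v)+\omega_\beta^{\mathcal E}(v_* )}$. $D(v,v_* )$ is the diagonal matrix $\|v_{\beta,\mathcal E}(v,v_* )-v\|_2I_d$ (isotropic case, $\kappa:=d$) or $\mathrm{diag}\{(v_{\beta,\mathcal E}(v,v_* )-v)_1,\dots,(v_{\beta,\mathcal E}(v,v_* )-v)_d\}$ (anisotropic case, $\kappa:=1$). The mean-field equation is: $f(\cdot,t)$ are probability densities with $f(\cdot,0)=f_0$ and, for smooth test functions $\phi$, $$\frac{d}{dt}\int f\phi\,dv=\lambda\int_{\mathbb R^{2d}}\gamma_\beta^{\mathcal E}(v,v_* )\nabla\phi(v)\cdot(v_*-v)f(v,t)f(v_*,t)\,dv\,dv_*+\frac{\sigma^2}{2}\int_{\mathbb R^{2d}}\sum_{i=1}^dD_{ii}^2(v,v_* )\partial_{ii}\phi(v)f(v,t)f(v_*,t)\,dv\,dv_*,$$ i.e. $\partial_tf+\lambda\nabla_v\cdot\big(f\int\gamma_\beta^{\mathcal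 E}(v,v_* )(v_*-v)f(v_*,t)dv_*\big)=\frac{\sigma^2}{2}\sum_i\partial_{v_i}^2\big(f\int D_{ii}^2(v,v_* )f(v_*,t)dv_*\big)$. Here $m(t):=\int vf(v,t)\,dv$ and $V(t):=\frac12\int|v-m(t)|^2f(v,t)\,dv$. *)

theory Defs
  imports "HOL-Analysis.Analysis" "HOL-Probability.Probability"
begin

definition partial_dir :: "'d::finite \<Rightarrow> (real^'d \<Rightarrow> real) \<Rightarrow> real^'d \<Rightarrow> real" where
  "partial_dir i \<phi> v = deriv (\<lambda>s. \<phi> (v + s *\<^sub>R axis i 1)) 0"

text \<open>A function is smooth iff it is continuous and all its partial derivatives exist
  everywhere and are again smooth (i.e. all iterated partials exist and are continuous).\<close>
coinductive smooth_fn :: "(real^'d::finite \<Rightarrow> real) \<Rightarrow> bool" where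
  "continuous_on UNIV \<phi> \<Longrightarrow>
   (\<forall>i. (\<forall>v. (\<lambda>s. \<phi> (v + s *\<^sub>R axis i 1)) differentiable (at 0))
        \<and> smooth_fn (partial_dir i \<phi>)) \<Longrightarrow> smooth_fn \<phi>"

definition test_fn :: "(real^'d::finite \<Rightarrow> real) \<Rightarrow> bool" where
  "test_fn \<phi> \<longleftrightarrow> smooth_fn \<phi> \<and> bounded {v. \<phi> v \<noteq> 0}"

definition has_grad_hess ::
  "(real^'d::finite \<Rightarrow> real) \<Rightarrow> (real^'d \<Rightarrow> real^'d) \<Rightarrow> (real^'d \<Rightarrow> real^'d^'d) \<Rightarrow> bool" where
  "has_grad_hess E g H \<longleftrightarrow>
     (\<forall>v. (E has_derivative (\<lambda>h. g v \<bullet> h)) (at v)) \<and>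
     (\<forall>v. (g has_derivative (\<lambda>h. H v *v h)) (at v)) \<and>
     continuous_on UNIV H"

definition omega :: "real \<Rightarrow> (real^'d::finite \<Rightarrow> real) \<Rightarrow> real^'d \<Rightarrow> real" where
  "omega \<beta> E v = exp (- \<beta> * E v)"

definition gammaw :: "real \<Rightarrow> (real^'d::finite \<Rightarrow> real) \<Rightarrow> real^'d \<Rightarrow> real^'d \<Rightarrow> real" where
  "gammaw \<beta> E v w = omega \<beta> E w / (omega \<beta> E v + omega \<beta> E w)"

definition vbeta :: "real \<Rightarrow> (real^'d::finite \<Rightarrow> real) \<Rightarrow> real^'d \<Rightarrow> real^'d \<Rightarrow> real^'d" where
  "vbeta \<beta> E v w = (1 / (omega \<beta> E v + omega \<beta> E w)) *\<^sub>R (omega \<beta> E v *\<^sub>R v + omega \<beta> E w *\<^sub>R w)"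

text \<open>Diagonal entries of the diffusion matrix D; \<open>aniso\<close> selects the anisotropic case.\<close>
definition Dii :: "bool \<Rightarrow> real \<Rightarrow> (real^'d::finite \<Rightarrow> real) \<Rightarrow> real^'d \<Rightarrow> real^'d \<Rightarrow> 'd \<Rightarrow> real" where
  "Dii aniso \<beta> E v w i =
     (if aniso then (vbeta \<beta> E v w - v) $ i else norm (vbeta \<beta> E v w - v))"

definition kappa :: "bool \<Rightarrow> 'd::finite itself \<Rightarrow> real" where
  "kappa aniso _ = (if aniso then 1 else real CARD('d))"

definition L1w :: "real \<Rightarrow> (real^'d::finite \<Rightarrow> real) \<Rightarrow> (real^'d \<Rightarrow> real) \<Rightarrow> real" where
  "L1w \<beta> E g = (\<integral>v. omega \<beta> E v * g v \<partial>lborel)"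

definition mf_rhs ::
  "bool \<Rightarrow> real \<Rightarrow> real \<Rightarrow> real \<Rightarrow> (real^'d::finite \<Rightarrow> real) \<Rightarrow> (real^'d \<Rightarrow> real \<Rightarrow> real)
    \<Rightarrow> (real^'d \<Rightarrow> real) \<Rightarrow> real \<Rightarrow> real" where
  "mf_rhs aniso lam \<sigma> \<beta> E f \<phi> t =
     lam * (\<integral>p. (case p of (v, w) \<Rightarrow>
             gammaw \<beta> E v w * (\<Sum>i\<in>UNIV. partial_dir i \<phi> v * (w - v) $ i) * f v t * f w t)
           \<partial>(lborel \<Otimes>\<^sub>M lborel))
   + \<sigma>\<^sup>2 / 2 * (\<integral>p. (case p of (v, w) \<Rightarrow>
             (\<Sum>i\<in>UNIV. (Dii aniso \<beta> E v w i)\<^sup>2 * partial_dir i (partial_dir i \<phi>) v) * f v t * f w t)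
           \<partial>(lborel \<Otimes>\<^sub>M lborel))"

definition mf_solution ::
  "bool \<Rightarrow> real \<Rightarrow> real \<Rightarrow> real \<Rightarrow> (real^'d::finite \<Rightarrow> real) \<Rightarrow> (real^'d \<Rightarrow> real \<Rightarrow> real)
    \<Rightarrow> (real^'d \<Rightarrow> real) \<Rightarrow> bool" where
  "mf_solution aniso lam \<sigma> \<beta> E f f0 \<longleftrightarrow>
     (\<forall>v. f v 0 = f0 v) \<and>
     (\<forall>t\<ge>0. (\<forall>v. f v t \<ge> 0) \<and> integrable lborel (\<lambda>v. f v t) \<and> (\<integral>v. f v t \<partial>lborel) = 1
            \<and> integrable lborel (\<lambda>v. (norm v)\<^sup>2 * f v t)) \<and>
     (\<forall>T\<ge>0. bdd_above ((\<lambda>t. \<integral>v. (norm v)\<^sup>2 * f v t \<partial>lborel) ` {0..T})) \<and>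
     (\<forall>\<phi>. test_fn \<phi> \<longrightarrow> (\<forall>t\<ge>0.
        (mf_rhs aniso lam \<sigma> \<beta> E f \<phi> has_integral
           ((\<integral>v. f v t * \<phi> v \<partial>lborel) - (\<integral>v. f0 v * \<phi> v \<partial>lborel))) {0..t}))"

definition mean :: "(real^'d::finite \<Rightarrow> real \<Rightarrow> real) \<Rightarrow> real \<Rightarrow> real^'d" where
  "mean f t = (\<integral>v. f v t *\<^sub>R v \<partial>lborel)"

definition var :: "(real^'d::finite \<Rightarrow> real \<Rightarrow> real) \<Rightarrow> real \<Rightarrow> real" where
  "var f t = 1/2 * (\<integral>v. (norm (v - mean f t))\<^sup>2 * f v t \<partial>lborel)"

end

theory Submission
  imports Defs "HOL-Computational_Algebra.Polynomial"
begin

text \<open>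
  Testing the equation with \<open>v\<close> and \<open>\<bar>v\<bar>\<^sup>2\<close> suffices. Since \<open>\<gamma>(v,w) + \<gamma>(w,v) = 1\<close>, symmetrising in
  \<open>(v,w)\<close> removes the cross term \<open>\<gamma> (v - m) \<bullet> (w - m)\<close> from \<open>V'\<close>, so \<open>V' \<le> -\<mu> V\<close> and
  \<open>V(t) \<le> e\<^bsup>-\<mu>t\<^esup> V(0)\<close>; it also gives \<open>\<bar>m'\<bar> \<le> \<lambda> V\<^bsup>1/2\<^esup>\<close>, hence \<open>m\<close> converges to some \<open>vt\<close> with
  \<open>\<bar>m(0) - vt\<bar> \<le> (2\<lambda>/\<mu>) V(0)\<^bsup>1/2\<^esup>\<close>. The weight \<open>\<omega>\<close> is Lipschitz with constant
  \<open>L = \<beta> c\<^sub>1 e\<^bsup>-\<beta> inf E\<^esup>\<close>, so \<open>\<parallel>\<omega>\<parallel> - \<omega>(vt) \<le> L \<integral>\<bar>v - vt\<bar> f\<^sub>0 \<le> L (\<surd>2 + 2\<lambda>/\<mu>) V(0)\<^bsup>1/2\<^esup>\<close>, which is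
  at most \<open>4 L (\<lambda>/\<mu>) V(0)\<^bsup>1/2\<^esup> < \<parallel>\<omega>\<parallel>/2\<close> because \<open>\<lambda> \<ge> \<mu>\<close>. Thus \<open>\<omega>(vt) \<ge> \<parallel>\<omega>\<parallel>/2\<close>.
\<close>

section \<open>Cutoffs of quadratic polynomials as test functions\<close>

text \<open>The equation is available only for compactly supported test functions and only
  integrated in time. Polynomials are therefore reached as limits of cutoffs whose first partials
  grow at most linearly and whose second partials stay bounded, uniformly in the cutoff radius; the
  bound on second moments over each [0,T] supplies the majorants. Since \<open>smooth_fn\<close>
  demands all iterated partials, the cutoff comes from an explicit family closed under
  differentiation. The rate \<mu> has two sources: the drift gives -2 lam V / (1 + C) <= -lam V / C,
  because gamma >= 1 / (1 + C) and C >= 1, and the diffusion gives (\<sigma>^2 / 2) \<kappa> times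
  at most E|w - v|^2 = 4 V. The bound on m' has constant lam because symmetrising leaves gamma -
  1/2, of modulus at most 1/2, against E|w - v| <= 2 V^(1/2). Integrating V^(1/2) <= e^(-\<mu> t /
  2) V(0)^(1/2) yields the factor 2 lam / \<mu>. The weight is compared only between the initial law
  and the limit point, so no evolution equation for it enters.\<close>

definition flat :: "real poly \<Rightarrow> real \<Rightarrow> real" where
  "flat p x = (if x > 0 then poly p (1 / x) * exp (- (1 / x)) else 0)"

text \<open>This is X^2 (p - p'): differentiating p(1/x) e^(-1/x) brings out 1/x^2 and turns p into
  p - p'. The family \<open>flat p\<close> is thus closed under differentiation, which is why the
  polynomial is a parameter.\<close>

definition flat' :: "real poly \<Rightarrow> real poly" where
  "flat' p = [:0, 0, 1:] * (p - pderiv p)"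

lemma poly_times_exp_minus_tendsto_0:
  fixes p :: "real poly"
  shows "((\<lambda>y. poly p y * exp (- y)) \<longlongrightarrow> 0) at_top"
proof -
  have "((\<lambda>y. \<Sum>i\<le>degree p. coeff p i * (y ^ i / exp y)) \<longlongrightarrow> (\<Sum>i\<le>degree p. coeff p i * 0)) at_top"
    by (intro tendsto_sum tendsto_mult tendsto_const tendsto_power_div_exp_0)
  then show ?thesis
    by (simp add: poly_altdef sum_distrib_right exp_minus divide_inverse mult.assoc)
qed

lemma has_real_derivative_flat:
  "(flat p has_real_derivative flat (flat' p) x) (at x)"
proof -
  consider "x > 0" | "x < 0" | "x = 0" by linarith
  then show ?thesis
  proof cases
    case 1
    have "((\<lambda>x. poly p (1 / x) * exp (- (1 / x))) has_real_derivative flat (flat' p) x) (at x)"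
      using 1 by (auto intro!: derivative_eq_intros DERIV_chain2[OF poly_DERIV]
          simp: flat_def flat'_def field_simps power2_eq_square)
    then show ?thesis
      by (rule has_field_derivative_transform_within_open[where S="{0<..}"])
        (use 1 in \<open>auto simp: flat_def\<close>)
  next
    case 2
    have "((\<lambda>x. 0) has_real_derivative flat (flat' p) x) (at x)"
      using 2 by (simp add: flat_def)
    then show ?thesis
      by (rule has_field_derivative_transform_within_open[where S="{..<0}"])
        (use 2 in \<open>auto simp: flat_def\<close>)
  next
    case 3
    \<comment> \<open>For h > 0 the difference quotient is (X p)(1/h) e^(-1/h), hence the extra
      factor X; the exponential beats every polynomial as 1/h tends to infinity.\<close>
    have "((\<lambda>h. poly ([:0, 1:] * p) (inverse h) * exp (- inverse h)) \<longlongrightarrow> 0) (at_right 0)"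
      by (rule filterlim_compose[OF poly_times_exp_minus_tendsto_0 filterlim_inverse_at_top_right])
    then have R: "((\<lambda>h. flat p h / h) \<longlongrightarrow> 0) (at_right 0)"
      by (rule Lim_transform_eventually)
        (auto simp: eventually_at_right_field flat_def field_simps intro!: exI[of _ 1])
    have L: "((\<lambda>h. flat p h / h) \<longlongrightarrow> 0) (at_left 0)"
      by (rule Lim_transform_eventually[OF tendsto_const])
        (auto simp: eventually_at_left_field flat_def intro!: exI[of _ "-1"])
    have "((\<lambda>h. flat p h / h) \<longlongrightarrow> 0) (at 0)"
      using L R by (rule filterlim_split_at)
    then show ?thesis
      using 3 by (simp add: DERIV_def flat_def)
  qed
qed

lemma continuous_on_flat: "continuous_on S (flat p)"
  using has_real_derivative_flat DERIV_continuous_on has_field_derivative_at_within by blast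

text \<open>In the estimates \<open>flat\<close> is applied to 1 - c |v|^2 with c > 0, so the range
  x <= 1 is enough; compactness handles [0, 1], and the function vanishes below 0.\<close>

lemma flat_bounded_le_1:
  obtains B where "B > 0" "\<And>x. x \<le> 1 \<Longrightarrow> \<bar>flat p x\<bar> \<le> B"
proof -
  have "bounded (flat p ` {0..1})"
    by (intro compact_imp_bounded compact_continuous_image continuous_on_flat) auto
  then obtain B where B: "B > 0" "\<And>x. x \<in> {0..1} \<Longrightarrow> \<bar>flat p x\<bar> \<le> B"
    unfolding bounded_pos by auto
  have "\<bar>flat p x\<bar> \<le> B" if "x \<le> 1" for x
    using B that by (cases "x \<ge> 0") (auto simp: flat_def)
  with B(1) show ?thesis using that by blast
qed

text \<open>A relation rather than \<open>partial_dir\<close>, because \<open>deriv\<close> is total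
  and says nothing about existence; with existence included, the sum and product rules
  compose.\<close>

definition has_partial :: "'d::finite \<Rightarrow> (real^'d \<Rightarrow> real) \<Rightarrow> (real^'d \<Rightarrow> real) \<Rightarrow> bool" where
  "has_partial i \<phi> \<psi> \<longleftrightarrow>
     (\<forall>v. ((\<lambda>s. \<phi> (v + s *\<^sub>R axis i 1)) has_real_derivative \<psi> v) (at 0))"

lemma has_partial_imp_partial_dir: "has_partial i \<phi> \<psi> \<Longrightarrow> partial_dir i \<phi> = \<psi>"
  unfolding has_partial_def partial_dir_def by (auto intro: DERIV_imp_deriv)

lemma has_partial_const: "has_partial i (\<lambda>v. k) (\<lambda>v. 0)"
  by (simp add: has_partial_def)

lemma has_partial_coord: "has_partial i (\<lambda>v. v $ j) (\<lambda>v. if i = j then 1 else 0)"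
  unfolding has_partial_def by (auto intro!: derivative_eq_intros simp: axis_def)

lemma has_partial_add:
  "has_partial i \<phi> \<phi>' \<Longrightarrow> has_partial i \<psi> \<psi>' \<Longrightarrow> has_partial i (\<lambda>v. \<phi> v + \<psi> v) (\<lambda>v. \<phi>' v + \<psi>' v)"
  unfolding has_partial_def by (auto intro!: derivative_eq_intros)

lemma has_partial_mult:
  "has_partial i \<phi> \<phi>' \<Longrightarrow> has_partial i \<psi> \<psi>' \<Longrightarrow>
    has_partial i (\<lambda>v. \<phi> v * \<psi> v) (\<lambda>v. \<phi>' v * \<psi> v + \<phi> v * \<psi>' v)"
  unfolding has_partial_def
proof (intro allI)
  fix v
  assume "\<forall>v. ((\<lambda>s. \<phi> (v + s *\<^sub>R axis i 1)) has_real_derivative \<phi>' v) (at 0)"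
    and "\<forall>v. ((\<lambda>s. \<psi> (v + s *\<^sub>R axis i 1)) has_real_derivative \<psi>' v) (at 0)"
  then show "((\<lambda>s. \<phi> (v + s *\<^sub>R axis i 1) * \<psi> (v + s *\<^sub>R axis i 1)) has_real_derivative
        \<phi>' v * \<psi> v + \<phi> v * \<psi>' v) (at 0)"
    using DERIV_mult[of "\<lambda>s. \<phi> (v + s *\<^sub>R axis i 1)" "\<phi>' v" 0 UNIV "\<lambda>s. \<psi> (v + s *\<^sub>R axis i 1)" "\<psi>' v"]
    by (simp add: mult.commute)
qed

lemma norm_sq_line:
  "(norm (v + s *\<^sub>R axis i 1))\<^sup>2 = (norm v)\<^sup>2 + 2 * s * v $ i + s\<^sup>2" for v :: "real^'d::finite"
  unfolding power2_norm_eq_inner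
  by (simp add: inner_add_left inner_add_right inner_axis inner_axis' inner_axis_axis
      power2_eq_square algebra_simps)

lemma has_partial_norm_sq: "has_partial i (\<lambda>v. (norm v)\<^sup>2) (\<lambda>v. 2 * v $ i)"
  unfolding has_partial_def norm_sq_line by (auto intro!: derivative_eq_intros)

lemma has_partial_inner: "has_partial i (\<lambda>v. u \<bullet> v) (\<lambda>v. u $ i)"
  unfolding has_partial_def
  by (auto simp: inner_add_right inner_axis intro!: derivative_eq_intros)

lemma has_partial_flat:
  "has_partial i (\<lambda>v. flat p (1 - c * (norm v)\<^sup>2)) (\<lambda>v. flat (flat' p) (1 - c * (norm v)\<^sup>2) * (- 2 * c * v $ i))"
  unfolding has_partial_def norm_sq_line
  by (intro allI DERIV_chain2[OF has_real_derivative_flat, THEN DERIV_cong])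
    (auto intro!: derivative_eq_intros)

text \<open>Serves as the coinduction invariant for \<open>smooth_fn\<close>: the partials of every
  member lie in the algebra again. The scale c is fixed since differentiating a cutoff changes its
  polynomial but not c.\<close>

inductive cutoff_alg :: "real \<Rightarrow> (real^'d::finite \<Rightarrow> real) \<Rightarrow> bool" for c where
  const: "cutoff_alg c (\<lambda>v. k)"
| coord: "cutoff_alg c (\<lambda>v. v $ i)"
| flat: "cutoff_alg c (\<lambda>v. flat p (1 - c * (norm v)\<^sup>2))"
| add: "cutoff_alg c \<phi> \<Longrightarrow> cutoff_alg c \<psi> \<Longrightarrow> cutoff_alg c (\<lambda>v. \<phi> v + \<psi> v)"
| mult: "cutoff_alg c \<phi> \<Longrightarrow> cutoff_alg c \<psi> \<Longrightarrow> cutoff_alg c (\<lambda>v. \<phi> v * \<psi> v)"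

lemma cutoff_alg_continuous: "cutoff_alg c \<phi> \<Longrightarrow> continuous_on UNIV \<phi>"
  by (induction rule: cutoff_alg.induct)
    (auto intro!: continuous_intros continuous_on_compose2[OF continuous_on_flat[of UNIV]])

lemma cutoff_alg_partial: "cutoff_alg c \<phi> \<Longrightarrow> \<exists>\<psi>. cutoff_alg c \<psi> \<and> has_partial i \<phi> \<psi>"
proof (induction rule: cutoff_alg.induct)
  case (flat p)
  show ?case
    by (rule exI, rule conjI[rotated], rule has_partial_flat) (intro cutoff_alg.mult cutoff_alg.flat cutoff_alg.const cutoff_alg.coord)
next
  case (add \<phi> \<psi>)
  then show ?case by (blast intro: has_partial_add cutoff_alg.add)
next
  case (mult \<phi> \<psi>)
  then obtain \<phi>' \<psi>' where "cutoff_alg c \<phi>'" "has_partial i \<phi> \<phi>'" "cutoff_alg c \<psi>'" "has_partial i \<psi> \<psi>'"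
    by blast
  with mult.hyps show ?case
    by (intro exI[of _ "\<lambda>v. \<phi>' v * \<psi> v + \<phi> v * \<psi>' v"] conjI has_partial_mult cutoff_alg.add cutoff_alg.mult)
qed (blast intro: has_partial_const has_partial_coord cutoff_alg.const)+

lemma cutoff_alg_smooth: "cutoff_alg c \<phi> \<Longrightarrow> smooth_fn \<phi>"
proof (coinduction arbitrary: \<phi>)
  case smooth_fn
  have "(\<lambda>s. \<phi> (v + s *\<^sub>R axis i 1)) differentiable (at 0)" "cutoff_alg c (partial_dir i \<phi>)" for i v
    using cutoff_alg_partial[OF smooth_fn, of i] has_partial_imp_partial_dir[of i \<phi>]
    by (auto simp: has_partial_def real_differentiable_def)
  with cutoff_alg_continuous[OF smooth_fn] show ?case by auto
qed

lemma cutoff_alg_sum: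
  "finite I \<Longrightarrow> (\<And>j. j \<in> I \<Longrightarrow> cutoff_alg c (\<phi> j)) \<Longrightarrow> cutoff_alg c (\<lambda>v. \<Sum>j\<in>I. \<phi> j v)"
  by (induction I rule: finite_induct) (auto intro: cutoff_alg.const cutoff_alg.add)

text \<open>One family for both tests: a = 0 gives the linear functionals that determine the mean, a
  = 1 half the squared norm plus a linear term, later used with u = - m(s). The factor 1/2 makes the
  gradient a v + u and every pure second partial equal to a.\<close>

definition quad :: "real \<Rightarrow> real^'d::finite \<Rightarrow> real^'d \<Rightarrow> real" where
  "quad a u v = a / 2 * (norm v)\<^sup>2 + u \<bullet> v"

lemma cutoff_alg_quad: "cutoff_alg c (quad a u)"
proof -
  have "quad a u = (\<lambda>v. a / 2 * (\<Sum>i\<in>UNIV. v $ i * v $ i) + (\<Sum>i\<in>UNIV. u $ i * v $ i))"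
    by (auto simp: quad_def power2_norm_eq_inner inner_vec_def)
  moreover have "cutoff_alg c \<dots>"
    by (intro cutoff_alg.add cutoff_alg.mult cutoff_alg_sum cutoff_alg.const cutoff_alg.coord) auto
  ultimately show ?thesis by simp
qed

lemma has_partial_quad: "has_partial i (quad a u) (\<lambda>v. a * v $ i + u $ i)"
  using has_partial_add[OF has_partial_mult[OF has_partial_const[of i "a/2"] has_partial_norm_sq] has_partial_inner[of i u]]
  by (simp add: quad_def[abs_def] algebra_simps)

text \<open>The constant polynomial e normalises the cutoff: it equals e times e^(-1) = 1 at the
  origin, and tends to 1 pointwise as c tends to 0.\<close>

definition cutoff_quad :: "real \<Rightarrow> real^'d::finite \<Rightarrow> real \<Rightarrow> real^'d \<Rightarrow> real" where
  "cutoff_quad a u c v = quad a u v * flat [:exp 1:] (1 - c * (norm v)\<^sup>2)"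

lemma test_fn_cutoff_quad:
  assumes "c > 0"
  shows "test_fn (cutoff_quad a u c)"
  unfolding test_fn_def
proof
  show "smooth_fn (cutoff_quad a u c)"
    unfolding cutoff_quad_def[abs_def]
    by (intro cutoff_alg_smooth[of c] cutoff_alg.mult cutoff_alg_quad cutoff_alg.flat)
  \<comment> \<open>A crude substitute for the radius c^(-1/2) that avoids the square root.\<close>
  have "norm v \<le> 1 + 1 / c" if "cutoff_quad a u c v \<noteq> 0" for v
  proof -
    have "c * (norm v)\<^sup>2 < 1"
      using that by (auto simp: cutoff_quad_def flat_def split: if_splits)
    then have "(norm v)\<^sup>2 \<le> 1 / c" using assms by (simp add: field_simps)
    also have "\<dots> \<le> (1 + 1 / c)\<^sup>2" using assms by (simp add: power2_eq_square field_simps)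
    finally show ?thesis by (rule power2_le_imp_le) (use assms in auto)
  qed
  then show "bounded {v. cutoff_quad a u c v \<noteq> 0}"
    by (auto simp: bounded_iff)
qed

lemma partial_cutoff_quad:
  "partial_dir i (cutoff_quad a u c) = (\<lambda>v. (a * v $ i + u $ i) * flat [:exp 1:] (1 - c * (norm v)\<^sup>2)
     + quad a u v * (flat (flat' [:exp 1:]) (1 - c * (norm v)\<^sup>2) * (- 2 * c * v $ i)))"
  unfolding cutoff_quad_def[abs_def]
  by (intro has_partial_imp_partial_dir has_partial_mult has_partial_quad has_partial_flat)

lemma partial2_cutoff_quad:
  "partial_dir i (partial_dir i (cutoff_quad a u c)) =
    (\<lambda>v. a * flat [:exp 1:] (1 - c * (norm v)\<^sup>2)
     + (a * v $ i + u $ i) * (flat (flat' [:exp 1:]) (1 - c * (norm v)\<^sup>2) * (- 2 * c * v $ i))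
     + ((a * v $ i + u $ i) * (flat (flat' [:exp 1:]) (1 - c * (norm v)\<^sup>2) * (- 2 * c * v $ i))
     + quad a u v * (flat (flat' (flat' [:exp 1:])) (1 - c * (norm v)\<^sup>2) * (- 2 * c * v $ i) * (- 2 * c * v $ i)
          + flat (flat' [:exp 1:]) (1 - c * (norm v)\<^sup>2) * (- 2 * c))))"
proof -
  have 1: "has_partial i (\<lambda>v. a * v $ i + u $ i) (\<lambda>v. a)" for i
    using has_partial_add[OF has_partial_mult[OF has_partial_const[of i a] has_partial_coord[of i i]] has_partial_const[of i "u $ i"]]
    by simp
  have 2: "has_partial i (\<lambda>v. - 2 * c * v $ i) (\<lambda>v. - 2 * c)" for i
    using has_partial_mult[OF has_partial_const[of i "-2 * c"] has_partial_coord[of i i]]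
    by simp
  show ?thesis
    unfolding partial_cutoff_quad
    by (intro has_partial_imp_partial_dir has_partial_add has_partial_mult has_partial_quad has_partial_flat 1 2)
qed

text \<open>The cutoff is supported in the ball of radius \<open>c\<close> to the power \<open>-1/2\<close>, so every
  factor \<open>c\<close> produced by differentiating it compensates two powers of \<open>norm v\<close>.\<close>

lemma cutoff_quad_bounds:
  fixes u :: "real^'d::finite"
  obtains K where "K > 0"
    "\<And>c v. 0 < c \<Longrightarrow> c \<le> 1 \<Longrightarrow> \<bar>cutoff_quad a u c v\<bar> \<le> K * (1 + (norm v)\<^sup>2)"
    "\<And>c v i. 0 < c \<Longrightarrow> c \<le> 1 \<Longrightarrow> \<bar>partial_dir i (cutoff_quad a u c) v\<bar> \<le> K * (1 + norm v)"
    "\<And>c v i. 0 < c \<Longrightarrow> c \<le> 1 \<Longrightarrow> \<bar>partial_dir i (partial_dir i (cutoff_quad a u c)) v\<bar> \<le> K"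
proof -
  define p0 p1 p2 where "p0 = [:exp 1 :: real:]" and "p1 = flat' p0" and "p2 = flat' p1"
  obtain B0 where B0: "B0 > 0" "\<And>x. x \<le> 1 \<Longrightarrow> \<bar>flat p0 x\<bar> \<le> B0"
    using flat_bounded_le_1 by metis
  obtain B1 where B1: "B1 > 0" "\<And>x. x \<le> 1 \<Longrightarrow> \<bar>flat p1 x\<bar> \<le> B1"
    using flat_bounded_le_1 by metis
  obtain B2 where B2: "B2 > 0" "\<And>x. x \<le> 1 \<Longrightarrow> \<bar>flat p2 x\<bar> \<le> B2"
    using flat_bounded_le_1 by metis
  define B where "B = B0 + B1 + B2"
  have B: "B > 0" "\<And>x. x \<le> 1 \<Longrightarrow> \<bar>flat p0 x\<bar> \<le> B" "\<And>x. x \<le> 1 \<Longrightarrow> \<bar>flat p1 x\<bar> \<le> B"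
    "\<And>x. x \<le> 1 \<Longrightarrow> \<bar>flat p2 x\<bar> \<le> B"
    using B0 B1 B2 unfolding B_def by force+
  define A where "A = \<bar>a\<bar> + norm u"
  have A: "A \<ge> 0" by (simp add: A_def)
  \<comment> \<open>21 = 1 + 4 + 4 + 8 + 4 counts the multiples of A B in the bound for the second
    partial, the largest of the three.\<close>
  define K where "K = 21 * (A + 1) * (B + 1)"
  have K: "K > 0" using A B(1) by (auto simp: K_def)
  have q: "\<bar>quad a u v\<bar> \<le> A * (norm v * (1 + norm v))" for v
  proof -
    have "\<bar>quad a u v\<bar> \<le> \<bar>a\<bar> / 2 * (norm v)\<^sup>2 + norm u * norm v"
      unfolding quad_def using Cauchy_Schwarz_ineq2[of u v] by (simp add: abs_mult abs_triangle_ineq[THEN order_trans])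
    also have "\<dots> \<le> A * (norm v * (1 + norm v))"
      by (simp add: A_def power2_eq_square algebra_simps)
    finally show ?thesis .
  qed
  have l: "\<bar>a * v $ i + u $ i\<bar> \<le> A * (1 + norm v)" for v and i :: 'd
  proof -
    have "\<bar>a * v $ i + u $ i\<bar> \<le> \<bar>a\<bar> * \<bar>v $ i\<bar> + \<bar>u $ i\<bar>"
      by (metis abs_mult abs_triangle_ineq)
    also have "\<dots> \<le> \<bar>a\<bar> * norm v + norm u"
      by (intro add_mono mult_left_mono component_le_norm_cart) auto
    also have "\<dots> \<le> A * (1 + norm v)"
      by (simp add: A_def algebra_simps)
    finally show ?thesis .
  qed
  have key: "\<bar>cutoff_quad a u c v\<bar> \<le> K * (1 + (norm v)\<^sup>2) \<and>
     \<bar>partial_dir i (cutoff_quad a u c) v\<bar> \<le> K * (1 + norm v) \<and>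
     \<bar>partial_dir i (partial_dir i (cutoff_quad a u c)) v\<bar> \<le> K"
    if c: "0 < c" "c \<le> 1" for c v and i :: 'd
  proof (cases "c * (norm v)\<^sup>2 < 1")
    case False
    then have "flat p (1 - c * (norm v)\<^sup>2) = 0" for p by (simp add: flat_def)
    then show ?thesis
      unfolding partial2_cutoff_quad unfolding partial_cutoff_quad cutoff_quad_def using K by simp
  next
    case True
    define n where "n = norm v"
    define x where "x = 1 - c * n\<^sup>2"
    have n: "n \<ge> 0" "c * n\<^sup>2 < 1" "\<bar>v $ i\<bar> \<le> n" using True component_le_norm_cart by (auto simp: n_def)
    \<comment> \<open>For n > 1 this follows from c n^2 < 1, for n <= 1 from c <= 1, the reason for
      restricting to c <= 1.\<close>
    have cn: "c * n \<le> 1"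
    proof (cases "n \<le> 1")
      case True then show ?thesis using c n mult_mono[of c 1 n 1] by simp
    next
      case False
      then have "c * n \<le> c * n\<^sup>2" using c by (simp add: power2_eq_square)
      with n show ?thesis by simp
    qed
    have x: "x \<le> 1" using c by (simp add: x_def)
    define f0 f1 f2 where "f0 = flat p0 x" and "f1 = flat p1 x" and "f2 = flat p2 x"
    have f: "\<bar>f0\<bar> \<le> B" "\<bar>f1\<bar> \<le> B" "\<bar>f2\<bar> \<le> B" using B x by (auto simp: f0_def f1_def f2_def)
    define L where "L = a * v $ i + u $ i"
    define Q where "Q = quad a u v"
    define d where "d = - 2 * c * v $ i"
    have L: "\<bar>L\<bar> \<le> A * (1 + n)" using l by (simp add: L_def n_def)
    have Q: "\<bar>Q\<bar> \<le> A * (n * (1 + n))" using q by (simp add: Q_def n_def)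
    have d: "\<bar>d\<bar> \<le> 2 * c * n" using n c by (simp add: d_def abs_mult)
    have "\<bar>Q * f0\<bar> \<le> A * (n * (1 + n)) * B"
      unfolding abs_mult by (intro mult_mono Q f) (use A n in auto)
    also have "\<dots> \<le> A * (2 * (1 + n\<^sup>2)) * B"
    proof -
      have "n * (1 + n) \<le> 2 * (1 + n\<^sup>2)" using sum_squares_bound[of n 1] n by (simp add: power2_eq_square algebra_simps)
      then show ?thesis using A B by (intro mult_right_mono mult_left_mono) auto
    qed
    also have "\<dots> \<le> K * (1 + n\<^sup>2)"
    proof -
      have "2 * (A * B) \<le> K" using A B(1) by (simp add: K_def algebra_simps)
      then show ?thesis using mult_right_mono[of "2 * (A * B)" K "1 + n\<^sup>2"] by (simp add: algebra_simps)
    qed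
    finally have 1: "\<bar>Q * f0\<bar> \<le> K * (1 + n\<^sup>2)" .
    have Lf0: "\<bar>L * f0\<bar> \<le> A * (1 + n) * B"
      unfolding abs_mult by (intro mult_mono L f) (use A n in auto)
    have fd: "\<bar>f1 * d\<bar> \<le> B * (2 * c * n)" "\<bar>f2 * d\<bar> \<le> B * (2 * c * n)"
      unfolding abs_mult by (intro mult_mono f d; use B in auto)+
    have Qfd: "\<bar>Q * (f1 * d)\<bar> \<le> A * (1 + n) * (2 * B)"
    proof -
      have "\<bar>Q * (f1 * d)\<bar> \<le> A * (n * (1 + n)) * (B * (2 * c * n))"
        unfolding abs_mult[of Q] by (intro mult_mono Q fd) (use A n in auto)
      also have "\<dots> = A * (1 + n) * (2 * B) * (c * n\<^sup>2)" by (simp add: power2_eq_square)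
      also have "\<dots> \<le> A * (1 + n) * (2 * B)" using n A B by (intro mult_left_le) auto
      finally show ?thesis .
    qed
    have 2: "\<bar>L * f0 + Q * (f1 * d)\<bar> \<le> K * (1 + n)"
    proof -
      have "\<bar>L * f0 + Q * (f1 * d)\<bar> \<le> A * (1 + n) * B + A * (1 + n) * (2 * B)"
        using Lf0 Qfd by linarith
      also have "\<dots> = (3 * (A * B)) * (1 + n)" by (simp add: algebra_simps)
      also have "\<dots> \<le> K * (1 + n)"
        using A B(1) n by (intro mult_right_mono) (simp_all add: K_def algebra_simps)
      finally show ?thesis .
    qed
    have cn2: "c * (n * (1 + n)) \<le> 2" using cn n by (simp add: algebra_simps power2_eq_square)
    have Lfd: "\<bar>L * (f1 * d)\<bar> \<le> 4 * A * B"
    proof -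
      have "\<bar>L * (f1 * d)\<bar> \<le> A * (1 + n) * (B * (2 * c * n))"
        unfolding abs_mult[of L] by (intro mult_mono L fd) (use A n in auto)
      also have "\<dots> = 2 * A * B * (c * (n * (1 + n)))" by (simp add: algebra_simps)
      also have "\<dots> \<le> 2 * A * B * 2" using A B by (intro mult_left_mono cn2) auto
      finally show ?thesis by simp
    qed
    have Qf2: "\<bar>Q * (f2 * d * d)\<bar> \<le> 8 * A * B"
    proof -
      have "\<bar>Q * (f2 * d * d)\<bar> \<le> A * (n * (1 + n)) * (B * (2 * c * n) * (2 * c * n))"
        unfolding abs_mult[of Q] abs_mult[of "f2 * d"]
        by (intro mult_mono Q fd d) (use A B c n in auto)
      also have "\<dots> = 4 * A * B * ((c * (n * (1 + n))) * (c * n\<^sup>2))" by (simp add: power2_eq_square algebra_simps)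
      also have "\<dots> \<le> 4 * A * B * (2 * 1)" using A B c n by (intro mult_left_mono mult_mono cn2) auto
      finally show ?thesis by simp
    qed
    have Qf1: "\<bar>Q * (f1 * (- 2 * c))\<bar> \<le> 4 * A * B"
    proof -
      have "\<bar>f1 * (- 2 * c)\<bar> \<le> B * (2 * c)" unfolding abs_mult using f c by (intro mult_mono) auto
      then have "\<bar>Q * (f1 * (- 2 * c))\<bar> \<le> A * (n * (1 + n)) * (B * (2 * c))"
        unfolding abs_mult[of Q] by (intro mult_mono Q) (use A n in auto)
      also have "\<dots> = 2 * A * B * (c * (n * (1 + n)))" by (simp add: algebra_simps)
      also have "\<dots> \<le> 2 * A * B * 2" using A B by (intro mult_left_mono cn2) auto
      finally show ?thesis by simp
    qed
    have af: "\<bar>a * f0\<bar> \<le> A * B" unfolding abs_mult using f A by (intro mult_mono) (auto simp: A_def)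
    have "\<bar>a * f0 + L * (f1 * d) + (L * (f1 * d) + Q * (f2 * d * d + f1 * (- 2 * c)))\<bar> \<le> K"
    proof -
      have "\<bar>a * f0 + L * (f1 * d) + (L * (f1 * d) + Q * (f2 * d * d + f1 * (- 2 * c)))\<bar>
        \<le> A * B + 4 * A * B + (4 * A * B + (8 * A * B + 4 * A * B))"
        unfolding distrib_left using af Lfd Qf2 Qf1 by linarith
      also have "\<dots> \<le> K" using A B(1) by (simp add: K_def algebra_simps)
      finally show ?thesis .
    qed
    with 1 2 show ?thesis
      unfolding partial2_cutoff_quad unfolding partial_cutoff_quad cutoff_quad_def
      by (simp only: f0_def f1_def f2_def p0_def p1_def p2_def x_def L_def Q_def d_def n_def)
  qed
  then show ?thesis using K that by blast
qed

text \<open>Each derivative of the cutoff carries a factor c, so only the terms in which every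
  derivative falls on the polynomial survive.\<close>

lemma cutoff_quad_tendsto:
  fixes c :: "nat \<Rightarrow> real"
  assumes "c \<longlonglongrightarrow> 0"
  shows "(\<lambda>n. cutoff_quad a u (c n) v) \<longlonglongrightarrow> quad a u v"
    and "(\<lambda>n. partial_dir i (cutoff_quad a u (c n)) v) \<longlonglongrightarrow> a * v $ i + u $ i"
    and "(\<lambda>n. partial_dir i (partial_dir i (cutoff_quad a u (c n))) v) \<longlonglongrightarrow> a"
proof -
  have F: "(\<lambda>n. flat p (1 - c n * (norm v)\<^sup>2)) \<longlonglongrightarrow> flat p (1 - 0 * (norm v)\<^sup>2)" for p
    by (intro isCont_tendsto_compose[of _ "flat p"] tendsto_intros assms)
      (use continuous_on_flat[of UNIV p] in \<open>auto simp: continuous_on_eq_continuous_at\<close>)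
  have F0: "flat [:exp 1:] 1 = 1" by (simp add: flat_def flip: exp_add)
  show "(\<lambda>n. cutoff_quad a u (c n) v) \<longlonglongrightarrow> quad a u v"
    unfolding cutoff_quad_def by (rule tendsto_eq_intros F assms refl)+ (simp add: F0)
  show "(\<lambda>n. partial_dir i (cutoff_quad a u (c n)) v) \<longlonglongrightarrow> a * v $ i + u $ i"
    unfolding partial_cutoff_quad by (rule tendsto_eq_intros F assms refl)+ (simp add: F0)
  show "(\<lambda>n. partial_dir i (partial_dir i (cutoff_quad a u (c n))) v) \<longlonglongrightarrow> a"
    unfolding partial2_cutoff_quad by (rule tendsto_eq_intros F assms refl)+ (simp add: F0)
qed

section \<open>Symmetric weights on square-integrable distributions\<close>

lemma (in prob_space) expectation_le_sqrt_expectation_square: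
  fixes X :: "'a \<Rightarrow> real"
  assumes "integrable M X" "integrable M (\<lambda>x. (X x)\<^sup>2)"
  shows "expectation X \<le> sqrt (expectation (\<lambda>x. (X x)\<^sup>2))"
proof -
  have "(expectation X)\<^sup>2 \<le> expectation (\<lambda>x. (X x)\<^sup>2)"
    using variance_positive[of X] variance_eq[OF assms] by simp
  then show ?thesis by (rule real_le_rsqrt)
qed

lemma norm_le_1_plus_sq: "norm (x :: 'b::real_normed_vector) \<le> 1 + (norm x)\<^sup>2"
proof (cases "norm x \<le> 1")
  case False
  then have "norm x * 1 \<le> norm x * norm x" by (intro mult_left_mono) auto
  then show ?thesis by (simp add: power2_eq_square)
qed (smt (verit) zero_le_power2)

lemma norm_add_sq_le: "(norm (x + y))\<^sup>2 \<le> 2 * (norm x)\<^sup>2 + 2 * (norm y)\<^sup>2"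
  for x y :: "'b::real_normed_vector"
proof -
  have "(norm (x + y))\<^sup>2 \<le> (norm x + norm y)\<^sup>2"
    by (intro power_mono norm_triangle_ineq norm_ge_zero)
  also have "\<dots> \<le> 2 * (norm x)\<^sup>2 + 2 * (norm y)\<^sup>2"
    using sum_squares_bound[of "norm x" "norm y"] by (simp add: power2_sum)
  finally show ?thesis .
qed

lemma norm_diff_sq_le: "(norm (x - y))\<^sup>2 \<le> 2 * (norm x)\<^sup>2 + 2 * (norm y)\<^sup>2"
  for x y :: "'b::real_normed_vector"
  using norm_add_sq_le[of x "- y"] by simp

text \<open>Estimates at a fixed time see the solution only as a law with finite second moment; the
  double integrals in v and w become expectations over two independent copies.\<close>

locale L2_distribution = prob_space M for M :: "'a::euclidean_space measure" +
  assumes sets_M [measurable_cong]: "sets M = sets borel"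
    and moment2: "integrable M (\<lambda>v. (norm v)\<^sup>2)"
begin

sublocale pair: pair_prob_space M M ..

definition "bary = (\<integral>v. v \<partial>M)"
definition "spread = 1 / 2 * (\<integral>v. (norm (v - bary))\<^sup>2 \<partial>M)"

lemma integrable_bound:
  fixes F :: "'a \<Rightarrow> 'b::{banach, second_countable_topology}"
  assumes [measurable]: "F \<in> borel_measurable M" and "\<And>v. norm (F v) \<le> K * (1 + (norm v)\<^sup>2)"
  shows "integrable M F"
proof (rule Bochner_Integration.integrable_bound)
  show "integrable M (\<lambda>v. K * (1 + (norm v)\<^sup>2))" using moment2 by simp
  show "AE v in M. norm (F v) \<le> norm (K * (1 + (norm v)\<^sup>2))"
    using assms(2) by (auto intro!: AE_I2 order_trans[OF _ abs_ge_self])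
qed simp

lemma integrable_id [simp, intro]: "integrable M (\<lambda>v. v)"
  by (rule integrable_bound[of _ 1]) (use norm_le_1_plus_sq in auto)

lemma integrable_diff_sq [simp, intro]: "integrable M (\<lambda>v. (norm (v - z))\<^sup>2)"
proof (rule integrable_bound[of _ "2 + 2 * (norm z)\<^sup>2"])
  fix v
  have "(norm (v - z))\<^sup>2 \<le> 2 * (norm v)\<^sup>2 + 2 * (norm z)\<^sup>2" by (rule norm_diff_sq_le)
  also have "\<dots> \<le> (2 + 2 * (norm z)\<^sup>2) * (1 + (norm v)\<^sup>2)" by (simp add: algebra_simps)
  finally show "norm ((norm (v - z))\<^sup>2) \<le> (2 + 2 * (norm z)\<^sup>2) * (1 + (norm v)\<^sup>2)" by simp
qed simp

lemma spread_nonneg: "0 \<le> spread"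
  by (simp add: spread_def)

lemma second_moment: "(\<integral>v. (norm v)\<^sup>2 \<partial>M) = 2 * spread + (norm bary)\<^sup>2"
proof -
  have "(norm (v - bary))\<^sup>2 = (norm v)\<^sup>2 - 2 * (bary \<bullet> v) + (norm bary)\<^sup>2" for v
    unfolding power2_norm_eq_inner by (simp add: algebra_simps inner_commute)
  then have "2 * spread = (\<integral>v. (norm v)\<^sup>2 - 2 * (bary \<bullet> v) + (norm bary)\<^sup>2 \<partial>M)"
    by (simp add: spread_def)
  also have "\<dots> = (\<integral>v. (norm v)\<^sup>2 \<partial>M) - 2 * (bary \<bullet> bary) + (norm bary)\<^sup>2"
    using moment2 by (simp add: prob_space bary_def)
  finally show ?thesis by (simp add: power2_norm_eq_inner)
qed

text \<open>Triangle inequality through the barycentre; sqrt 2 arises because \<open>spread\<close>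
  is half the variance.\<close>

lemma expectation_dist_le: "(\<integral>v. norm (v - z) \<partial>M) \<le> sqrt (2 * spread) + norm (bary - z)"
proof -
  have I: "integrable M (\<lambda>v. norm (v - y))" for y by simp
  have "(\<integral>v. norm (v - z) \<partial>M) \<le> (\<integral>v. norm (v - bary) + norm (bary - z) \<partial>M)"
    using norm_triangle_ineq[of "_ - bary" "bary - z"] by (intro integral_mono I Bochner_Integration.integrable_add) auto
  also have "\<dots> = (\<integral>v. norm (v - bary) \<partial>M) + norm (bary - z)"
    using I by (simp add: prob_space)
  also have "(\<integral>v. norm (v - bary) \<partial>M) \<le> sqrt (\<integral>v. (norm (v - bary))\<^sup>2 \<partial>M)"
    by (intro expectation_le_sqrt_expectation_square I) auto
  finally show ?thesis by (simp add: spread_def)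
qed

lemma integrable_pair_fst:
  fixes g :: "'a \<Rightarrow> 'b::{banach, second_countable_topology}"
  assumes "integrable M g"
  shows "integrable (M \<Otimes>\<^sub>M M) (\<lambda>p. g (fst p))"
    and "(\<integral>p. g (fst p) \<partial>(M \<Otimes>\<^sub>M M)) = (\<integral>v. g v \<partial>M)"
proof -
  have "integrable (distr (M \<Otimes>\<^sub>M M) M fst) g" using assms by (simp add: distr_pair_fst)
  then show "integrable (M \<Otimes>\<^sub>M M) (\<lambda>p. g (fst p))"
    by (rule integrable_distr[OF measurable_fst])
  have "(\<integral>v. g v \<partial>distr (M \<Otimes>\<^sub>M M) M fst) = (\<integral>p. g (fst p) \<partial>(M \<Otimes>\<^sub>M M))"
    using assms by (intro integral_distr) auto
  then show "(\<integral>p. g (fst p) \<partial>(M \<Otimes>\<^sub>M M)) = (\<integral>v. g v \<partial>M)" by (simp add: distr_pair_fst)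
qed

lemma integral_pair_swap:
  fixes F :: "'a \<times> 'a \<Rightarrow> real"
  assumes "F \<in> borel_measurable (M \<Otimes>\<^sub>M M)"
  shows "(\<integral>p. F (snd p, fst p) \<partial>(M \<Otimes>\<^sub>M M)) = (\<integral>p. F p \<partial>(M \<Otimes>\<^sub>M M))"
  using pair.integral_product_swap[OF assms] by (simp add: case_prod_beta')

lemma integrable_pair_snd:
  fixes g :: "'a \<Rightarrow> real"
  assumes "integrable M g"
  shows "integrable (M \<Otimes>\<^sub>M M) (\<lambda>p. g (snd p))"
    and "(\<integral>p. g (snd p) \<partial>(M \<Otimes>\<^sub>M M)) = (\<integral>v. g v \<partial>M)"
proof -
  show "integrable (M \<Otimes>\<^sub>M M) (\<lambda>p. g (snd p))"
    using pair.integrable_product_swap[OF integrable_pair_fst(1)[OF assms]] by (simp add: case_prod_beta')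
  show "(\<integral>p. g (snd p) \<partial>(M \<Otimes>\<^sub>M M)) = (\<integral>v. g v \<partial>M)"
    using integral_pair_swap[of "\<lambda>p. g (fst p)"] integrable_pair_fst[OF assms] by auto
qed

lemma integrable_pair_bound:
  fixes F :: "'a \<times> 'a \<Rightarrow> real"
  assumes [measurable]: "F \<in> borel_measurable (M \<Otimes>\<^sub>M M)"
    and "\<And>v w. \<bar>F (v, w)\<bar> \<le> K * (1 + (norm v)\<^sup>2 + (norm w)\<^sup>2)"
  shows "integrable (M \<Otimes>\<^sub>M M) F"
proof (rule Bochner_Integration.integrable_bound)
  show "integrable (M \<Otimes>\<^sub>M M) (\<lambda>p. K * (1 + (norm (fst p))\<^sup>2 + (norm (snd p))\<^sup>2))"
    by (intro integrable_mult_right Bochner_Integration.integrable_add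
        integrable_pair_fst(1)[where g="\<lambda>v. (norm v)\<^sup>2"] integrable_pair_snd(1)[where g="\<lambda>v. (norm v)\<^sup>2"] moment2) simp
  show "AE p in M \<Otimes>\<^sub>M M. norm (F p) \<le> norm (K * (1 + (norm (fst p))\<^sup>2 + (norm (snd p))\<^sup>2))"
    using assms(2) by (auto intro!: AE_I2 order_trans[OF _ abs_ge_self])
qed simp

lemma expectation_pair_le:
  fixes F :: "'a \<times> 'a \<Rightarrow> real"
  assumes [measurable]: "F \<in> borel_measurable (M \<Otimes>\<^sub>M M)"
    and *: "\<And>v w. \<bar>F (v, w)\<bar> \<le> K * (1 + (norm v)\<^sup>2 + (norm w)\<^sup>2)"
  shows "\<bar>\<integral>p. F p \<partial>(M \<Otimes>\<^sub>M M)\<bar> \<le> K * (1 + 2 * (\<integral>v. (norm v)\<^sup>2 \<partial>M))"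
proof -
  note 1 = integrable_pair_fst[where g="\<lambda>v. (norm v)\<^sup>2", OF moment2]
  note 2 = integrable_pair_snd[where g="\<lambda>v. (norm v)\<^sup>2", OF moment2]
  have "\<bar>\<integral>p. F p \<partial>(M \<Otimes>\<^sub>M M)\<bar> \<le> (\<integral>p. \<bar>F p\<bar> \<partial>(M \<Otimes>\<^sub>M M))"
    by (rule integral_abs_bound)
  also have "\<dots> \<le> (\<integral>p. K * (1 + (norm (fst p))\<^sup>2 + (norm (snd p))\<^sup>2) \<partial>(M \<Otimes>\<^sub>M M))"
    using 1 2 * by (intro integral_mono integrable_abs integrable_pair_bound[OF assms]) auto
  also have "\<dots> = K * (1 + 2 * (\<integral>v. (norm v)\<^sup>2 \<partial>M))"
    using 1 2 by (simp add: pair.P.prob_space)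
  finally show ?thesis .
qed

text \<open>The coordinates are independent under the product measure: integrating out the second
  one first leaves an inner product with the mean of a centred variable.\<close>

lemma integral_pair_inner_centred:
  "integrable (M \<Otimes>\<^sub>M M) (\<lambda>p. (fst p - bary) \<bullet> (snd p - bary))"
  "(\<integral>p. (fst p - bary) \<bullet> (snd p - bary) \<partial>(M \<Otimes>\<^sub>M M)) = 0"
proof -
  show I: "integrable (M \<Otimes>\<^sub>M M) (\<lambda>p. (fst p - bary) \<bullet> (snd p - bary))"
  proof (rule Bochner_Integration.integrable_bound)
    show "integrable (M \<Otimes>\<^sub>M M) (\<lambda>p. (norm (fst p - bary))\<^sup>2 + (norm (snd p - bary))\<^sup>2)"
      by (intro Bochner_Integration.integrable_add integrable_pair_fst(1)[where g="\<lambda>v. (norm (v - bary))\<^sup>2"]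
          integrable_pair_snd(1)[where g="\<lambda>v. (norm (v - bary))\<^sup>2"]) auto
    have "\<bar>x \<bullet> y\<bar> \<le> (norm x)\<^sup>2 + (norm y)\<^sup>2" for x y :: 'a
      using Cauchy_Schwarz_ineq2[of x y] sum_squares_bound[of "norm x" "norm y"]
        mult_nonneg_nonneg[OF norm_ge_zero[of x] norm_ge_zero[of y]] by linarith
    then show "AE p in M \<Otimes>\<^sub>M M. norm ((fst p - bary) \<bullet> (snd p - bary))
        \<le> norm ((norm (fst p - bary))\<^sup>2 + (norm (snd p - bary))\<^sup>2)" by simp
  qed measurable
  have "(\<integral>w. (v - bary) \<bullet> (w - bary) \<partial>M) = 0" for v
  proof -
    have "(\<integral>w. (v - bary) \<bullet> (w - bary) \<partial>M) = (v - bary) \<bullet> (\<integral>w. w - bary \<partial>M)"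
      by (rule integral_inner_right) simp
    also have "(\<integral>w. w - bary \<partial>M) = 0" by (simp add: prob_space bary_def)
    finally show ?thesis by simp
  qed
  then show "(\<integral>p. (fst p - bary) \<bullet> (snd p - bary) \<partial>(M \<Otimes>\<^sub>M M)) = 0"
    using pair.integral_fst'[OF I] by simp
qed

text \<open>For independent copies the mean squared distance is twice the variance, hence four times
  \<open>spread\<close>.\<close>

lemma integral_pair_diff_sq:
  "integrable (M \<Otimes>\<^sub>M M) (\<lambda>p. (norm (snd p - fst p))\<^sup>2)"
  "(\<integral>p. (norm (snd p - fst p))\<^sup>2 \<partial>(M \<Otimes>\<^sub>M M)) = 4 * spread"
proof -
  note 1 = integrable_pair_fst[where g="\<lambda>v. (norm (v - bary))\<^sup>2", OF integrable_diff_sq]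
  note 2 = integrable_pair_snd[where g="\<lambda>v. (norm (v - bary))\<^sup>2", OF integrable_diff_sq]
  note 3 = integral_pair_inner_centred
  have eq: "(norm (snd p - fst p))\<^sup>2 = (norm (fst p - bary))\<^sup>2 + (norm (snd p - bary))\<^sup>2
      - 2 * ((fst p - bary) \<bullet> (snd p - bary))" for p :: "'a \<times> 'a"
    unfolding power2_norm_eq_inner by (simp add: algebra_simps inner_commute)
  show "integrable (M \<Otimes>\<^sub>M M) (\<lambda>p. (norm (snd p - fst p))\<^sup>2)"
    unfolding eq using 1(1) 2(1) 3(1) by (intro Bochner_Integration.integrable_add Bochner_Integration.integrable_diff) auto
  show "(\<integral>p. (norm (snd p - fst p))\<^sup>2 \<partial>(M \<Otimes>\<^sub>M M)) = 4 * spread"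
    unfolding eq using 1 2 3 by (simp add: spread_def)
qed

end

text \<open>Retains of \<open>gammaw\<close> only what the estimates use: complementarity under
  exchange and a lower bound. Since \<open>wmin\<close> is nonnegative, complementarity also forces
  \<open>wt\<close> to be at most 1.\<close>

locale weighted_L2_distribution = L2_distribution M for M :: "'a::euclidean_space measure" +
  fixes wt :: "'a \<Rightarrow> 'a \<Rightarrow> real" and wmin :: real
  assumes wt_measurable [measurable]: "(\<lambda>p. wt (fst p) (snd p)) \<in> borel_measurable (M \<Otimes>\<^sub>M M)"
    and wt_sym: "wt v w + wt w v = 1"
    and wmin_nonneg: "0 \<le> wmin"
    and wt_ge: "wmin \<le> wt v w"
begin

lemma wt_nonneg: "0 \<le> wt v w"
  using wmin_nonneg wt_ge order_trans by blast

lemma wt_le_1: "wt v w \<le> 1"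
  using wt_sym[of v w] wt_nonneg[of w v] by simp

lemma integrable_wt_mult:
  assumes "integrable (M \<Otimes>\<^sub>M M) F"
  shows "integrable (M \<Otimes>\<^sub>M M) (\<lambda>p. wt (fst p) (snd p) * (F p :: real))"
proof (rule Bochner_Integration.integrable_bound[OF assms])
  show "AE p in M \<Otimes>\<^sub>M M. norm (wt (fst p) (snd p) * F p) \<le> norm (F p)"
    using wt_nonneg wt_le_1 by (auto simp: abs_mult intro!: mult_left_le_one_le)
qed (use assms in measurable)

text \<open>The inner product is symmetric, so only the average \<open>1/2\<close> of \<open>wt v w\<close> and \<open>wt w v\<close> matters.\<close>

lemma integral_wt_inner_centred:
  "(\<integral>p. wt (fst p) (snd p) * ((fst p - bary) \<bullet> (snd p - bary)) \<partial>(M \<Otimes>\<^sub>M M)) = 0" (is "?I = 0")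
proof -
  note I = integral_pair_inner_centred(1)
  have "?I + ?I = ?I + (\<integral>p. wt (snd p) (fst p) * ((snd p - bary) \<bullet> (fst p - bary)) \<partial>(M \<Otimes>\<^sub>M M))"
    using integral_pair_swap[of "\<lambda>p. wt (fst p) (snd p) * ((fst p - bary) \<bullet> (snd p - bary))"] by simp
  also have "(\<lambda>p. wt (snd p) (fst p) * ((snd p - bary) \<bullet> (fst p - bary))) =
      (\<lambda>p. (fst p - bary) \<bullet> (snd p - bary) - wt (fst p) (snd p) * ((fst p - bary) \<bullet> (snd p - bary)))"
  proof
    fix p :: "'a \<times> 'a"
    have "wt (snd p) (fst p) = 1 - wt (fst p) (snd p)" using wt_sym[of "fst p" "snd p"] by simp
    then show "wt (snd p) (fst p) * ((snd p - bary) \<bullet> (fst p - bary)) =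
      (fst p - bary) \<bullet> (snd p - bary) - wt (fst p) (snd p) * ((fst p - bary) \<bullet> (snd p - bary))"
      by (simp add: left_diff_distrib inner_commute[of "snd p - bary"])
  qed
  also have "?I + integral\<^sup>L (M \<Otimes>\<^sub>M M) \<dots> = 0"
    using I integrable_wt_mult[OF I] integral_pair_inner_centred(2) by simp
  finally show ?thesis by simp
qed

text \<open>Writing w - v as (w - bary) - (v - bary), the cross term integrates to 0 and J is minus
  the weighted integral of |v - bary|^2, which wmin <= wt <= 1 bounds on both sides. The upper bound
  gives dissipation, the lower one controls how fast the variance can fall.\<close>

lemma integral_wt_drift:
  defines "J \<equiv> \<integral>p. wt (fst p) (snd p) * ((fst p - bary) \<bullet> (snd p - fst p)) \<partial>(M \<Otimes>\<^sub>M M)"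
  shows "integrable (M \<Otimes>\<^sub>M M) (\<lambda>p. wt (fst p) (snd p) * ((fst p - bary) \<bullet> (snd p - fst p)))"
    and "J \<le> - 2 * wmin * spread" and "- 2 * spread \<le> J"
proof -
  note I = integrable_pair_fst[where g="\<lambda>v. (norm (v - bary))\<^sup>2", OF integrable_diff_sq]
  note W = integrable_wt_mult[OF I(1)] integrable_wt_mult[OF integral_pair_inner_centred(1)]
  have eq: "wt (fst p) (snd p) * ((fst p - bary) \<bullet> (snd p - fst p)) =
     wt (fst p) (snd p) * ((fst p - bary) \<bullet> (snd p - bary)) - wt (fst p) (snd p) * (norm (fst p - bary))\<^sup>2" for p
    unfolding right_diff_distrib[symmetric] power2_norm_eq_inner by (simp add: algebra_simps)
  show "integrable (M \<Otimes>\<^sub>M M) (\<lambda>p. wt (fst p) (snd p) * ((fst p - bary) \<bullet> (snd p - fst p)))"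
    unfolding eq using W by simp
  have J: "J = - (\<integral>p. wt (fst p) (snd p) * (norm (fst p - bary))\<^sup>2 \<partial>(M \<Otimes>\<^sub>M M))"
    unfolding J_def eq using W integral_wt_inner_centred by simp
  have s: "(\<integral>p. (norm (fst p - bary))\<^sup>2 \<partial>(M \<Otimes>\<^sub>M M)) = 2 * spread"
    using I by (simp add: spread_def)
  have "(\<integral>p. wmin * (norm (fst p - bary))\<^sup>2 \<partial>(M \<Otimes>\<^sub>M M)) \<le> - J"
    unfolding J minus_minus using I(1) W(1) wt_ge by (intro integral_mono mult_right_mono) auto
  then show "J \<le> - 2 * wmin * spread" by (simp add: s)
  have "- J \<le> (\<integral>p. 1 * (norm (fst p - bary))\<^sup>2 \<partial>(M \<Otimes>\<^sub>M M))"
    unfolding J minus_minus using I(1) W(1) wt_le_1 by (intro integral_mono mult_right_mono) auto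
  then show "- 2 * spread \<le> J" by (simp add: s)
qed

text \<open>Since w - v changes sign under exchange, symmetrising replaces \<open>wt\<close> by wt -
  1/2; the factor 1/2 gained this way cancels the 2 in sqrt (4 * spread).\<close>

lemma integral_wt_inner_diff:
  "integrable (M \<Otimes>\<^sub>M M) (\<lambda>p. wt (fst p) (snd p) * (u \<bullet> (snd p - fst p)))" (is ?int)
  "\<bar>\<integral>p. wt (fst p) (snd p) * (u \<bullet> (snd p - fst p)) \<partial>(M \<Otimes>\<^sub>M M)\<bar> \<le> norm u * sqrt spread" (is "\<bar>?I\<bar> \<le> _")
proof -
  note D = integral_pair_diff_sq
  have N: "integrable (M \<Otimes>\<^sub>M M) (\<lambda>p. norm (snd p - fst p))"
    by (rule Bochner_Integration.integrable_bound[OF Bochner_Integration.integrable_add[OF pair.P.integrable_const[of "1::real"] D(1)]])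
      (auto intro!: AE_I2 norm_le_1_plus_sq)
  have U: "integrable (M \<Otimes>\<^sub>M M) (\<lambda>p. u \<bullet> (snd p - fst p))"
    by (rule Bochner_Integration.integrable_bound[OF integrable_mult_right[OF N, of "norm u"]])
      (auto simp: abs_mult intro: Cauchy_Schwarz_ineq2)
  show ?int by (rule integrable_wt_mult[OF U])
  have "2 * ?I = ?I + (\<integral>p. wt (snd p) (fst p) * (u \<bullet> (fst p - snd p)) \<partial>(M \<Otimes>\<^sub>M M))"
    using integral_pair_swap[of "\<lambda>p. wt (fst p) (snd p) * (u \<bullet> (snd p - fst p))"] by simp
  also have "(\<lambda>p. wt (snd p) (fst p) * (u \<bullet> (fst p - snd p))) =
     (\<lambda>p. wt (fst p) (snd p) * (u \<bullet> (snd p - fst p)) - u \<bullet> (snd p - fst p))"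
  proof
    fix p :: "'a \<times> 'a"
    have "wt (snd p) (fst p) = 1 - wt (fst p) (snd p)" using wt_sym[of "fst p" "snd p"] by simp
    then show "wt (snd p) (fst p) * (u \<bullet> (fst p - snd p)) =
       wt (fst p) (snd p) * (u \<bullet> (snd p - fst p)) - u \<bullet> (snd p - fst p)"
      by (simp add: left_diff_distrib inner_diff_right right_diff_distrib)
  qed
  also have "?I + integral\<^sup>L (M \<Otimes>\<^sub>M M) \<dots> = (\<integral>p. (2 * wt (fst p) (snd p) - 1) * (u \<bullet> (snd p - fst p)) \<partial>(M \<Otimes>\<^sub>M M))"
    using U integrable_wt_mult[OF U] by (simp add: left_diff_distrib mult.assoc)
  finally have eq: "2 * ?I = (\<integral>p. (2 * wt (fst p) (snd p) - 1) * (u \<bullet> (snd p - fst p)) \<partial>(M \<Otimes>\<^sub>M M))" .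
  have "\<bar>2 * ?I\<bar> \<le> (\<integral>p. \<bar>(2 * wt (fst p) (snd p) - 1) * (u \<bullet> (snd p - fst p))\<bar> \<partial>(M \<Otimes>\<^sub>M M))"
    unfolding eq by (rule integral_abs_bound)
  also have "\<dots> \<le> (\<integral>p. norm u * norm (snd p - fst p) \<partial>(M \<Otimes>\<^sub>M M))"
  proof (rule integral_mono)
    show "integrable (M \<Otimes>\<^sub>M M) (\<lambda>p. \<bar>(2 * wt (fst p) (snd p) - 1) * (u \<bullet> (snd p - fst p))\<bar>)"
      using U integrable_wt_mult[OF U] by (simp add: left_diff_distrib mult.assoc)
    fix p
    have "\<bar>2 * wt (fst p) (snd p) - 1\<bar> \<le> 1" using wt_nonneg[of "fst p" "snd p"] wt_le_1[of "fst p" "snd p"] by auto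
    then have "\<bar>2 * wt (fst p) (snd p) - 1\<bar> * \<bar>u \<bullet> (snd p - fst p)\<bar> \<le> 1 * (norm u * norm (snd p - fst p))"
      by (intro mult_mono Cauchy_Schwarz_ineq2) auto
    then show "\<bar>(2 * wt (fst p) (snd p) - 1) * (u \<bullet> (snd p - fst p))\<bar> \<le> norm u * norm (snd p - fst p)"
      by (simp add: abs_mult)
  qed (use N in simp)
  also have "\<dots> = norm u * (\<integral>p. norm (snd p - fst p) \<partial>(M \<Otimes>\<^sub>M M))" by simp
  also have "\<dots> \<le> norm u * sqrt (4 * spread)"
    using pair.P.expectation_le_sqrt_expectation_square[OF N D(1)] D(2)
    by (intro mult_left_mono) auto
  also have "\<dots> = 2 * (norm u * sqrt spread)" by (simp add: real_sqrt_mult)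
  finally show "\<bar>?I\<bar> \<le> norm u * sqrt spread" by simp
qed

lemma integral_wt_sq_diff_sq:
  defines "D \<equiv> \<integral>p. (wt (fst p) (snd p))\<^sup>2 * (norm (snd p - fst p))\<^sup>2 \<partial>(M \<Otimes>\<^sub>M M)"
  shows "0 \<le> D" "D \<le> 4 * spread"
proof -
  show "0 \<le> D" by (simp add: D_def)
  have "D \<le> (\<integral>p. (norm (snd p - fst p))\<^sup>2 \<partial>(M \<Otimes>\<^sub>M M))"
    unfolding D_def power2_eq_square[of "wt _ _"] mult.assoc
    using integral_pair_diff_sq(1) wt_nonneg wt_le_1
    by (intro integral_mono integrable_wt_mult) (auto intro!: mult_left_le_one_le mult_le_one simp: mult.assoc[symmetric])
  then show "D \<le> 4 * spread" by (simp add: integral_pair_diff_sq(2))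
qed

end

section \<open>Moments of the mean-field solution\<close>

text \<open>A monotonicity criterion without differentiability: over n equal steps the errors add up
  to K T^2 / n, which vanishes as n grows.\<close>

lemma le_start_if_quadratic_increments:
  fixes h :: "real \<Rightarrow> real"
  assumes T: "0 \<le> T" and h: "\<And>s t. 0 \<le> s \<Longrightarrow> s \<le> t \<Longrightarrow> t \<le> T \<Longrightarrow> h t - h s \<le> K * (t - s)\<^sup>2"
  shows "h T \<le> h 0"
proof -
  have bound: "h T - h 0 \<le> K * T\<^sup>2 * inverse (real (Suc n))" for n
  proof -
    define x where "x k = real k * T / real (Suc n)" for k
    have x: "0 \<le> x k" "x k \<le> x (Suc k)" "x (Suc k) - x k = T / real (Suc n)" for k
      using T by (auto simp: x_def distrib_right add_divide_distrib intro!: divide_right_mono)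
    have xT: "x k \<le> T" if "k \<le> Suc n" for k
      using T that mult_right_mono[of "real k" "real (Suc n)" T] by (simp add: x_def field_simps)
    have "h T - h 0 = h (x (Suc n)) - h (x 0)" by (simp add: x_def)
    also have "\<dots> = (\<Sum>k<Suc n. h (x (Suc k)) - h (x k))" by (rule sum_lessThan_telescope[symmetric])
    also have "\<dots> \<le> (\<Sum>k<Suc n. K * (T / real (Suc n))\<^sup>2)"
      using h[OF x(1) x(2) xT] by (intro sum_mono) (auto simp: x(3))
    also have "\<dots> = real (Suc n) * (K * (T / real (Suc n))\<^sup>2)"
      by (simp only: sum_constant card_lessThan)
    also have "\<dots> = K * T\<^sup>2 * inverse (real (Suc n))"
      by (simp add: power2_eq_square divide_inverse del: of_nat_Suc)
    finally show ?thesis .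
  qed
  have "(\<lambda>n. K * T\<^sup>2 * inverse (real (Suc n))) \<longlonglongrightarrow> K * T\<^sup>2 * 0"
    by (intro tendsto_intros LIMSEQ_inverse_real_of_nat)
  then have "h T - h 0 \<le> K * T\<^sup>2 * 0"
    by (rule LIMSEQ_le_const) (use bound in auto)
  then show ?thesis by simp
qed

text \<open>The integrating factor argument for increments: those of e^(\<mu> t) V(t) are bounded by
  a multiple of (t - s)^2, because the linear terms cancel.\<close>

lemma exponential_decay_if_increments:
  fixes V :: "real \<Rightarrow> real"
  assumes T: "0 \<le> T" and \<mu>: "0 \<le> \<mu>" and K: "0 \<le> K"
    and V: "\<And>t. 0 \<le> t \<Longrightarrow> 0 \<le> V t"
    and inc: "\<And>s t. 0 \<le> s \<Longrightarrow> s \<le> t \<Longrightarrow> t \<le> T \<Longrightarrow> V t - V s \<le> - \<mu> * (t - s) * V s + K * (t - s)\<^sup>2"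
  shows "V T \<le> exp (- \<mu> * T) * V 0"
proof -
  define h where "h t = exp (\<mu> * t) * V t" for t
  have "h t - h s \<le> (exp (\<mu> * T) * K) * (t - s)\<^sup>2" if st: "0 \<le> s" "s \<le> t" "t \<le> T" for s t
  proof -
    \<comment> \<open>The right-hand side is expressed at the right endpoint t, so that it cancels -
      \<mu> (t - s) V(s) exactly once the increment of V is multiplied by exp (\<mu> * t)
      too.\<close>
    have "exp (\<mu> * t) - exp (\<mu> * s) \<le> exp (\<mu> * t) * (\<mu> * (t - s))"
    proof -
      have "1 + (- (\<mu> * (t - s))) \<le> exp (- (\<mu> * (t - s)))" by (rule exp_ge_add_one_self)
      then have "exp (\<mu> * t) * (1 - \<mu> * (t - s)) \<le> exp (\<mu> * t) * exp (- (\<mu> * (t - s)))"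
        by (intro mult_left_mono) auto
      also have "\<dots> = exp (\<mu> * s)" by (simp add: exp_add[symmetric] algebra_simps)
      finally show ?thesis by (simp add: algebra_simps)
    qed
    then have 1: "(exp (\<mu> * t) - exp (\<mu> * s)) * V s \<le> exp (\<mu> * t) * (\<mu> * (t - s)) * V s"
      using V st by (intro mult_right_mono) auto
    have 2: "exp (\<mu> * t) * (V t - V s) \<le> exp (\<mu> * t) * (- \<mu> * (t - s) * V s + K * (t - s)\<^sup>2)"
      using inc[OF st] by (intro mult_left_mono) auto
    have "h t - h s = exp (\<mu> * t) * (V t - V s) + (exp (\<mu> * t) - exp (\<mu> * s)) * V s"
      by (simp add: h_def algebra_simps)
    also have "\<dots> \<le> exp (\<mu> * t) * (K * (t - s)\<^sup>2)"
      using 1 2 by (simp add: algebra_simps)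
    also have "\<dots> \<le> exp (\<mu> * T) * (K * (t - s)\<^sup>2)"
      using st \<mu> K by (intro mult_right_mono) (auto intro: mult_left_mono)
    finally show ?thesis by (simp add: mult.assoc)
  qed
  from le_start_if_quadratic_increments[OF T this] have "exp (\<mu> * T) * V T \<le> V 0" by (simp add: h_def)
  then show ?thesis by (simp add: exp_minus field_simps)
qed

lemma has_integral_upper_bound:
  fixes g :: "real \<Rightarrow> real"
  assumes "(g has_integral I) {s..t}" "s \<le> t" "\<And>x. x \<in> {s..t} \<Longrightarrow> g x \<le> k"
  shows "I \<le> k * (t - s)"
  using has_integral_le[OF assms(1) has_integral_const_real[of k s t]] assms by (simp add: mult.commute)

lemma has_integral_lower_bound:
  fixes g :: "real \<Rightarrow> real"
  assumes "(g has_integral I) {s..t}" "s \<le> t" "\<And>x. x \<in> {s..t} \<Longrightarrow> k \<le> g x"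
  shows "k * (t - s) \<le> I"
  using has_integral_le[OF has_integral_const_real[of k s t] assms(1)] assms by (simp add: mult.commute)

text \<open>Division by x that covers x = 0; applied with x the norm of an increment of the
  mean.\<close>

lemma le_if_square_le_mult: "x * x \<le> x * y \<Longrightarrow> 0 \<le> y \<Longrightarrow> x \<le> y" for x y :: real
  by (cases "x \<le> 0") (auto simp: mult_le_cancel_left)

section \<open>The coefficients of the equation: the weight gamma and the diffusion matrix\<close>

lemma smooth_fn_continuous: "smooth_fn \<phi> \<Longrightarrow> continuous_on UNIV \<phi>"
  by (auto elim: smooth_fn.cases)

lemma smooth_fn_partial_dir: "smooth_fn \<phi> \<Longrightarrow> smooth_fn (partial_dir i \<phi>)"
  by (auto elim: smooth_fn.cases)

lemma omega_pos: "0 < omega \<beta> E v"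
  by (simp add: omega_def)

lemma gammaw_sym: "gammaw \<beta> E v w + gammaw \<beta> E w v = 1"
  using add_pos_pos[OF omega_pos[of \<beta> E v] omega_pos[of \<beta> E w]]
  by (simp add: gammaw_def add.commute flip: add_divide_distrib)

text \<open>\<open>gammaw\<close> is the logistic expression 1 / (1 + e^(\<beta> (E w - E v))),
  decreasing in E w - E v, which the oscillation of E bounds from above.\<close>

lemma gammaw_ge:
  assumes "0 < \<beta>" "bdd_below (range E)" "bdd_above (range E)"
  shows "1 / (1 + exp (\<beta> * (Sup (range E) - Inf (range E)))) \<le> gammaw \<beta> E v w"
proof -
  have "E w - E v \<le> Sup (range E) - Inf (range E)"
    using assms by (intro diff_mono cSup_upper cInf_lower) auto
  then have "exp (\<beta> * (E w - E v)) \<le> exp (\<beta> * (Sup (range E) - Inf (range E)))"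
    using assms(1) by (simp add: mult_left_mono)
  moreover have "gammaw \<beta> E v w = 1 / (1 + exp (\<beta> * (E w - E v)))"
    by (simp add: gammaw_def omega_def divide_simps exp_diff exp_minus algebra_simps add_nonneg_eq_0_iff)
  ultimately show ?thesis by (simp add: frac_le add_pos_pos)
qed

lemma vbeta_minus: "vbeta \<beta> E v w - v = gammaw \<beta> E v w *\<^sub>R (w - v)"
proof -
  define a where "a = omega \<beta> E v"
  define b where "b = omega \<beta> E w"
  have "a + b > 0" unfolding a_def b_def by (intro add_pos_pos omega_pos)
  then have v: "v = (1 / (a + b)) *\<^sub>R ((a + b) *\<^sub>R v)" by simp
  have "(1 / (a + b)) *\<^sub>R (a *\<^sub>R v + b *\<^sub>R w) - (1 / (a + b)) *\<^sub>R ((a + b) *\<^sub>R v) = (1 / (a + b)) *\<^sub>R (b *\<^sub>R (w - v))"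
    by (simp only: scaleR_diff_right[symmetric]) (simp add: algebra_simps)
  then show ?thesis
    unfolding vbeta_def gammaw_def a_def[symmetric] b_def[symmetric] using v by simp
qed

text \<open>The origin of \<kappa>: with y the displacement towards \<open>vbeta\<close>, the
  isotropic matrix contributes |y|^2 once per coordinate, the anisotropic one the squared
  coordinates, which sum to |y|^2. Only this trace enters, since the pure second partials of
  \<open>quad\<close> all coincide.\<close>

lemma sum_Dii_sq:
  fixes v w :: "real^'d::finite"
  shows "(\<Sum>i\<in>UNIV. (Dii aniso \<beta> E v w i)\<^sup>2) =
    kappa aniso TYPE('d) * ((gammaw \<beta> E v w)\<^sup>2 * (norm (w - v))\<^sup>2)"
proof -
  define y where "y = vbeta \<beta> E v w - v"
  have "(\<Sum>i\<in>UNIV. (y $ i)\<^sup>2) = (norm y)\<^sup>2"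
    unfolding power2_norm_eq_inner by (simp add: inner_vec_def power2_eq_square)
  then have "(\<Sum>i\<in>UNIV. (Dii aniso \<beta> E v w i)\<^sup>2) = kappa aniso TYPE('d) * (norm y)\<^sup>2"
    by (simp add: Dii_def kappa_def flip: y_def)
  then show ?thesis by (simp add: y_def vbeta_minus power_mult_distrib)
qed

lemma kappa_pos: "0 < kappa aniso TYPE('d::finite)"
  by (simp add: kappa_def)

section \<open>The laws of the solution and the equation in terms of expectations\<close>

locale mean_field =
  fixes E :: "real^'d::finite \<Rightarrow> real" and lam \<sigma> \<beta> :: real and aniso :: bool
    and f :: "real^'d \<Rightarrow> real \<Rightarrow> real" and f0 :: "real^'d \<Rightarrow> real"
  assumes contE: "continuous_on UNIV E"
    and bdd_belowE: "bdd_below (range E)" and bdd_aboveE: "bdd_above (range E)"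
    and lam_nonneg: "0 \<le> lam" and \<beta>_pos: "0 < \<beta>"
    and sol: "mf_solution aniso lam \<sigma> \<beta> E f f0"
begin

definition M where "M t = density lborel (\<lambda>v. ennreal (f v t))"

abbreviation "gam \<equiv> gammaw \<beta> E"
definition "Cexp = exp (\<beta> * (Sup (range E) - Inf (range E)))"
definition "\<mu> = lam / Cexp - 2 * \<sigma>\<^sup>2 * kappa aniso TYPE('d)"

lemma Cexp_ge_1: "1 \<le> Cexp"
proof -
  have "Inf (range E) \<le> Sup (range E)"
    using bdd_belowE bdd_aboveE cInf_lower[of "E 0" "range E"] cSup_upper[of "E 0" "range E"] by auto
  then show ?thesis using \<beta>_pos by (simp add: Cexp_def)
qed

lemma E_measurable [measurable]: "E \<in> borel_measurable borel"
  using contE by (rule borel_measurable_continuous_onI)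

lemma sets_M [measurable_cong]: "sets (M t) = sets borel"
  by (simp add: M_def)

lemma f_nonneg: "0 \<le> t \<Longrightarrow> 0 \<le> f v t"
  and f_integrable: "0 \<le> t \<Longrightarrow> integrable lborel (\<lambda>v. f v t)"
  and f_mass: "0 \<le> t \<Longrightarrow> (\<integral>v. f v t \<partial>lborel) = 1"
  and f_moment2: "0 \<le> t \<Longrightarrow> integrable lborel (\<lambda>v. (norm v)\<^sup>2 * f v t)"
  and f_init: "f v 0 = f0 v"
  and f_moment2_bdd: "0 \<le> t \<Longrightarrow> bdd_above ((\<lambda>t. \<integral>v. (norm v)\<^sup>2 * f v t \<partial>lborel) ` {0..t})"
  and f_weak: "test_fn \<phi> \<Longrightarrow> 0 \<le> t \<Longrightarrow> (mf_rhs aniso lam \<sigma> \<beta> E f \<phi> has_integral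
           ((\<integral>v. f v t * \<phi> v \<partial>lborel) - (\<integral>v. f0 v * \<phi> v \<partial>lborel))) {0..t}"
proof -
  note S = sol[unfolded mf_solution_def, THEN conjunct1]
    sol[unfolded mf_solution_def, THEN conjunct2, THEN conjunct1]
    sol[unfolded mf_solution_def, THEN conjunct2, THEN conjunct2, THEN conjunct1]
    sol[unfolded mf_solution_def, THEN conjunct2, THEN conjunct2, THEN conjunct2]
  show "f v 0 = f0 v" using S(1) by simp
  {
    assume t: "0 \<le> t"
    show "0 \<le> f v t" "integrable lborel (\<lambda>v. f v t)" "(\<integral>v. f v t \<partial>lborel) = 1"
      "integrable lborel (\<lambda>v. (norm v)\<^sup>2 * f v t)"
      using S(2)[rule_format, OF t] by simp_all
    show "bdd_above ((\<lambda>t. \<integral>v. (norm v)\<^sup>2 * f v t \<partial>lborel) ` {0..t})"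
      using S(3)[rule_format, OF t] .
    assume "test_fn \<phi>"
    then show "(mf_rhs aniso lam \<sigma> \<beta> E f \<phi> has_integral
           ((\<integral>v. f v t * \<phi> v \<partial>lborel) - (\<integral>v. f0 v * \<phi> v \<partial>lborel))) {0..t}"
      using S(4)[rule_format, OF _ t] by blast
  }
qed

lemma f_measurable: "0 \<le> t \<Longrightarrow> (\<lambda>v. f v t) \<in> borel_measurable borel"
  using borel_measurable_integrable[OF f_integrable] by simp

lemma integral_M:
  fixes F :: "real^'d \<Rightarrow> 'b::{banach, second_countable_topology}"
  assumes "0 \<le> t" "F \<in> borel_measurable borel"
  shows "(\<integral>v. F v \<partial>M t) = (\<integral>v. f v t *\<^sub>R F v \<partial>lborel)"
  unfolding M_def using assms f_measurable f_nonneg by (intro integral_density) auto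

lemma prob_space_M: "0 \<le> t \<Longrightarrow> prob_space (M t)"
proof (rule prob_spaceI)
  assume t: "0 \<le> t"
  note [measurable] = f_measurable[OF t]
  have "emeasure (M t) (space (M t)) = (\<integral>\<^sup>+v. ennreal (f v t) \<partial>lborel)"
    by (simp add: M_def emeasure_density)
  also have "\<dots> = ennreal (\<integral>v. f v t \<partial>lborel)"
    using t f_nonneg f_integrable by (intro nn_integral_eq_integral) auto
  finally show "emeasure (M t) (space (M t)) = 1" using t by (simp add: f_mass)
qed

lemma weighted_L2_M:
  assumes t: "0 \<le> t"
  shows "weighted_L2_distribution (M t) gam (1 / (1 + Cexp))"
proof -
  note [measurable] = f_measurable[OF t]
  interpret prob_space "M t" using t by (rule prob_space_M)
  have "integrable (M t) (\<lambda>v. (norm v)\<^sup>2)"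
    unfolding M_def using f_moment2[OF t] f_nonneg[OF t] by (subst integrable_density) (auto simp: mult.commute)
  moreover have "(\<lambda>p. gam (fst p) (snd p)) \<in> borel_measurable (M t \<Otimes>\<^sub>M M t)"
    unfolding gammaw_def omega_def by measurable
  moreover have "0 \<le> 1 / (1 + Cexp)" by (simp add: Cexp_def add_nonneg_nonneg)
  ultimately show ?thesis
    using gammaw_sym gammaw_ge[OF \<beta>_pos bdd_belowE bdd_aboveE]
    by unfold_locales (auto simp: sets_M Cexp_def)
qed

lemma L2_M: "0 \<le> t \<Longrightarrow> L2_distribution (M t)"
  by (rule weighted_L2_distribution.axioms(1)[OF weighted_L2_M])

lemma bary_M: "0 \<le> t \<Longrightarrow> L2_distribution.bary (M t) = mean f t"
  by (simp add: L2_distribution.bary_def[OF L2_M] mean_def integral_M)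

lemma spread_M: "0 \<le> t \<Longrightarrow> L2_distribution.spread (M t) = var f t"
  by (simp add: L2_distribution.spread_def[OF L2_M] var_def integral_M bary_M mult.commute)

lemma integral_pair_M:
  fixes F :: "(real^'d) \<times> (real^'d) \<Rightarrow> real"
  assumes t: "0 \<le> t" and F: "F \<in> borel_measurable (borel \<Otimes>\<^sub>M borel)"
  shows "(\<integral>p. F p \<partial>(M t \<Otimes>\<^sub>M M t)) = (\<integral>p. F p * f (fst p) t * f (snd p) t \<partial>(lborel \<Otimes>\<^sub>M lborel))"
proof -
  note [measurable] = f_measurable[OF t] F
  interpret prob_space "M t" using t by (rule prob_space_M)
  have "M t \<Otimes>\<^sub>M M t = density (lborel \<Otimes>\<^sub>M lborel) (\<lambda>(x, y). ennreal (f x t) * ennreal (f y t))"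
    unfolding M_def
    by (intro pair_measure_density)
      (auto simp: lborel.sigma_finite_measure_axioms M_def[symmetric] sigma_finite_measure_axioms)
  also have "(\<lambda>(x, y). ennreal (f x t) * ennreal (f y t)) = (\<lambda>p. ennreal (f (fst p) t * f (snd p) t))"
    using f_nonneg[OF t] by (auto simp: ennreal_mult)
  finally have "(\<integral>p. F p \<partial>(M t \<Otimes>\<^sub>M M t)) =
      (\<integral>p. F p \<partial>density (lborel \<Otimes>\<^sub>M lborel) (\<lambda>p. ennreal (f (fst p) t * f (snd p) t)))" by simp
  also have "\<dots> = (\<integral>p. (f (fst p) t * f (snd p) t) *\<^sub>R F p \<partial>(lborel \<Otimes>\<^sub>M lborel))"
    using f_nonneg[OF t] by (intro integral_density) auto
  finally show ?thesis by (simp add: mult_ac)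
qed

text \<open>The right-hand side of the equation evaluated formally at \<open>quad a u\<close>, with
  the sum of the squared \<open>Dii\<close> already rewritten by \<open>sum_Dii_sq\<close>.\<close>

definition Q :: "real \<Rightarrow> real^'d \<Rightarrow> real \<Rightarrow> real" where
  "Q a u t = lam * (\<integral>p. gam (fst p) (snd p) * ((a *\<^sub>R fst p + u) \<bullet> (snd p - fst p)) \<partial>(M t \<Otimes>\<^sub>M M t))
     + \<sigma>\<^sup>2 / 2 * (\<integral>p. a * (kappa aniso TYPE('d) * ((gam (fst p) (snd p))\<^sup>2 * (norm (snd p - fst p))\<^sup>2)) \<partial>(M t \<Otimes>\<^sub>M M t))"

text \<open>The drift integrand without the densities, which have moved into the measure
  \<open>M t\<close>; \<open>H\<close> below is its diffusion counterpart.\<close>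

definition G :: "(real^'d \<Rightarrow> real) \<Rightarrow> (real^'d) \<times> (real^'d) \<Rightarrow> real" where
  "G \<phi> p = gam (fst p) (snd p) * (\<Sum>i\<in>UNIV. partial_dir i \<phi> (fst p) * (snd p - fst p) $ i)"

definition H :: "(real^'d \<Rightarrow> real) \<Rightarrow> (real^'d) \<times> (real^'d) \<Rightarrow> real" where
  "H \<phi> p = (\<Sum>i\<in>UNIV. (Dii aniso \<beta> E (fst p) (snd p) i)\<^sup>2 * partial_dir i (partial_dir i \<phi>) (fst p))"

lemma G_H_measurable:
  assumes "smooth_fn \<phi>"
  shows "G \<phi> \<in> borel_measurable (borel \<Otimes>\<^sub>M borel)" "H \<phi> \<in> borel_measurable (borel \<Otimes>\<^sub>M borel)"
proof -
  have [measurable]: "partial_dir i \<phi> \<in> borel_measurable borel"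
    "partial_dir i (partial_dir i \<phi>) \<in> borel_measurable borel" for i
    using assms by (auto intro!: borel_measurable_continuous_onI smooth_fn_continuous smooth_fn_partial_dir)
  have [measurable]: "(\<lambda>v. v $ i) \<in> borel_measurable (borel :: (real^'d) measure)" for i
    by (intro borel_measurable_continuous_onI continuous_intros)
  show "G \<phi> \<in> borel_measurable (borel \<Otimes>\<^sub>M borel)"
    unfolding G_def[abs_def] gammaw_def omega_def by measurable
  show "H \<phi> \<in> borel_measurable (borel \<Otimes>\<^sub>M borel)"
    unfolding H_def[abs_def] Dii_def vbeta_minus gammaw_def omega_def
    by (cases aniso) simp_all
qed

lemma mf_rhs_eq:
  assumes "0 \<le> t" "smooth_fn \<phi>"
  shows "mf_rhs aniso lam \<sigma> \<beta> E f \<phi> t =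
    lam * (\<integral>p. G \<phi> p \<partial>(M t \<Otimes>\<^sub>M M t)) + \<sigma>\<^sup>2 / 2 * (\<integral>p. H \<phi> p \<partial>(M t \<Otimes>\<^sub>M M t))"
  unfolding mf_rhs_def integral_pair_M[OF assms(1) G_H_measurable(1)[OF assms(2)]]
    integral_pair_M[OF assms(1) G_H_measurable(2)[OF assms(2)]]
  by (simp add: G_def H_def case_prod_beta')

lemma G_bound:
  assumes "\<And>i v. \<bar>partial_dir i \<phi> v\<bar> \<le> K * (1 + norm v)" "0 \<le> K"
  shows "\<bar>G \<phi> (v, w)\<bar> \<le> 3 * real CARD('d) * K * (1 + (norm v)\<^sup>2 + (norm w)\<^sup>2)"
proof -
  \<comment> \<open>Any time would do: the interpretation supplies only 0 <= gam <= 1.\<close>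
  interpret weighted_L2_distribution "M 0" gam "1 / (1 + Cexp)" by (rule weighted_L2_M) simp
  have "\<bar>\<Sum>i\<in>UNIV. partial_dir i \<phi> v * (w - v) $ i\<bar> \<le> (\<Sum>i\<in>UNIV. \<bar>partial_dir i \<phi> v * (w - v) $ i\<bar>)"
    by (rule sum_abs)
  also have "\<dots> \<le> (\<Sum>i\<in>(UNIV::'d set). K * (1 + norm v) * (norm v + norm w))"
    unfolding abs_mult
    using component_le_norm_cart[of "w - v"] norm_triangle_ineq4[of w v] assms(2)
    by (intro sum_mono mult_mono assms(1)) (auto intro: order_trans simp: add.commute)
  also have "\<dots> = real CARD('d) * K * ((1 + norm v) * (norm v + norm w))" by simp
  also have "(1 + norm v) * (norm v + norm w) \<le> 3 * (1 + (norm v)\<^sup>2 + (norm w)\<^sup>2)"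
  proof -
    have "(1 + norm v) * (norm v + norm w) = norm v + norm w + (norm v)\<^sup>2 + norm v * norm w"
      by (simp add: algebra_simps power2_eq_square)
    then show ?thesis
      using norm_le_1_plus_sq[of v] norm_le_1_plus_sq[of w] sum_squares_bound[of "norm v" "norm w"]
        zero_le_power2[of "norm v"] zero_le_power2[of "norm w"] unfolding distrib_left by linarith
  qed
  finally have "\<bar>\<Sum>i\<in>UNIV. partial_dir i \<phi> v * (w - v) $ i\<bar> \<le> real CARD('d) * K * (3 * (1 + (norm v)\<^sup>2 + (norm w)\<^sup>2))"
    using assms(2) by (simp add: mult_left_mono)
  then have "gam v w * \<bar>\<Sum>i\<in>UNIV. partial_dir i \<phi> v * (w - v) $ i\<bar> \<le> 1 * (real CARD('d) * K * (3 * (1 + (norm v)\<^sup>2 + (norm w)\<^sup>2)))"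
    using wt_nonneg[of v w] wt_le_1[of v w] by (intro mult_mono) auto
  then show ?thesis using wt_nonneg[of v w] by (simp add: G_def abs_mult mult_ac)
qed

lemma H_bound:
  assumes "\<And>i v. \<bar>partial_dir i (partial_dir i \<phi>) v\<bar> \<le> K" "0 \<le> K"
  shows "\<bar>H \<phi> (v, w)\<bar> \<le> 2 * kappa aniso TYPE('d) * K * (1 + (norm v)\<^sup>2 + (norm w)\<^sup>2)"
proof -
  interpret weighted_L2_distribution "M 0" gam "1 / (1 + Cexp)" by (rule weighted_L2_M) simp
  have "\<bar>H \<phi> (v, w)\<bar> \<le> (\<Sum>i\<in>UNIV. \<bar>(Dii aniso \<beta> E v w i)\<^sup>2 * partial_dir i (partial_dir i \<phi>) v\<bar>)"
    unfolding H_def fst_conv snd_conv by (rule sum_abs)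
  also have "\<dots> \<le> (\<Sum>i\<in>(UNIV::'d set). (Dii aniso \<beta> E v w i)\<^sup>2 * K)"
    unfolding abs_mult using assms by (intro sum_mono mult_mono) auto
  also have "\<dots> = kappa aniso TYPE('d) * K * ((gam v w)\<^sup>2 * (norm (w - v))\<^sup>2)"
    by (simp add: sum_distrib_right[symmetric] sum_Dii_sq)
  also have "\<dots> \<le> kappa aniso TYPE('d) * K * (1 * (2 * (norm w)\<^sup>2 + 2 * (norm v)\<^sup>2))"
    using assms(2) kappa_pos[where 'd='d, of aniso] wt_nonneg[of v w] wt_le_1[of v w]
    by (intro mult_left_mono mult_mono norm_diff_sq_le power_le_one) auto
  also have "\<dots> \<le> kappa aniso TYPE('d) * K * (2 * (1 + (norm v)\<^sup>2 + (norm w)\<^sup>2))"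
    using assms(2) kappa_pos[where 'd='d, of aniso] by (intro mult_left_mono) auto
  finally show ?thesis by (simp add: mult_ac)
qed

section \<open>Passage from cutoffs to quadratic polynomials\<close>

lemma second_moment_bound:
  assumes "0 \<le> T"
  obtains B where "0 \<le> B" "\<And>t. 0 \<le> t \<Longrightarrow> t \<le> T \<Longrightarrow> (\<integral>v. (norm v)\<^sup>2 \<partial>M t) \<le> B"
proof -
  obtain B where B: "\<And>t. t \<in> {0..T} \<Longrightarrow> (\<integral>v. (norm v)\<^sup>2 * f v t \<partial>lborel) \<le> B"
    using f_moment2_bdd[OF assms] unfolding bdd_above_def by blast
  have "(\<integral>v. (norm v)\<^sup>2 \<partial>M t) \<le> max 0 B" if "0 \<le> t" "t \<le> T" for t
    using B[of t] that by (simp add: integral_M mult.commute)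
  then show ?thesis using that[of "max 0 B"] by simp
qed

text \<open>Dominated convergence on two levels. At a fixed time the quadratic majorants from
  \<open>G_bound\<close> and \<open>H_bound\<close> are integrable for the product law; in time, the
  second moment bound on [0,t] makes the right-hand sides uniformly bounded. The second level also
  yields the integrability of \<open>Q a u\<close> in time.\<close>

lemma quad_weak_formulation_from_0:
  assumes t: "0 \<le> t"
  shows "(Q a u has_integral ((\<integral>v. quad a u v \<partial>M t) - (\<integral>v. quad a u v \<partial>M 0))) {0..t}"
proof -
  define c where "c n = inverse (real (Suc n))" for n
  have c: "0 < c n" "c n \<le> 1" "c \<longlonglongrightarrow> 0" for n
    using LIMSEQ_inverse_real_of_nat by (auto simp: c_def[abs_def] field_simps)
  define \<phi> where "\<phi> n = cutoff_quad a u (c n)" for n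
  obtain K where K: "K > 0" "\<And>n v. \<bar>\<phi> n v\<bar> \<le> K * (1 + (norm v)\<^sup>2)"
    "\<And>n v i. \<bar>partial_dir i (\<phi> n) v\<bar> \<le> K * (1 + norm v)"
    "\<And>n v i. \<bar>partial_dir i (partial_dir i (\<phi> n)) v\<bar> \<le> K"
    unfolding \<phi>_def using c(1,2) cutoff_quad_bounds[of a u] by metis
  have lim: "(\<lambda>n. \<phi> n v) \<longlonglongrightarrow> quad a u v"
    "(\<lambda>n. partial_dir i (\<phi> n) v) \<longlonglongrightarrow> a * v $ i + u $ i"
    "(\<lambda>n. partial_dir i (partial_dir i (\<phi> n)) v) \<longlonglongrightarrow> a" for v i
    unfolding \<phi>_def by (intro cutoff_quad_tendsto c)+
  have test: "test_fn (\<phi> n)" for n unfolding \<phi>_def by (intro test_fn_cutoff_quad c)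
  then have smooth: "smooth_fn (\<phi> n)" for n by (simp add: test_fn_def)
  have [measurable]: "\<phi> n \<in> borel_measurable borel" for n
    by (intro borel_measurable_continuous_onI smooth_fn_continuous smooth)
  have [measurable]: "quad a u \<in> borel_measurable borel"
    unfolding quad_def[abs_def] by measurable
  obtain B where B: "0 \<le> B" "\<And>s. 0 \<le> s \<Longrightarrow> s \<le> t \<Longrightarrow> (\<integral>v. (norm v)\<^sup>2 \<partial>M s) \<le> B"
    using second_moment_bound[OF t] by blast
  define KG where "KG = 3 * real CARD('d) * K"
  define KH where "KH = 2 * kappa aniso TYPE('d) * K"
  have KGH: "0 \<le> KG" "0 \<le> KH" using K(1) kappa_pos[where 'd='d, of aniso] by (auto simp: KG_def KH_def)
  have Gb: "\<bar>G (\<phi> n) (v, w)\<bar> \<le> KG * (1 + (norm v)\<^sup>2 + (norm w)\<^sup>2)" for n v w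
    unfolding KG_def using K by (intro G_bound) auto
  have Hb: "\<bar>H (\<phi> n) (v, w)\<bar> \<le> KH * (1 + (norm v)\<^sup>2 + (norm w)\<^sup>2)" for n v w
    unfolding KH_def using K by (intro H_bound) auto
  have Glim: "(\<lambda>n. G (\<phi> n) p) \<longlonglongrightarrow> gam (fst p) (snd p) * ((a *\<^sub>R fst p + u) \<bullet> (snd p - fst p))" for p
  proof -
    have "(\<lambda>n. G (\<phi> n) p) \<longlonglongrightarrow> gam (fst p) (snd p) * (\<Sum>i\<in>UNIV. (a * fst p $ i + u $ i) * (snd p - fst p) $ i)"
      unfolding G_def by (intro tendsto_intros lim)
    then show ?thesis by (simp add: inner_vec_def)
  qed
  have Hlim: "(\<lambda>n. H (\<phi> n) p) \<longlonglongrightarrow> a * (kappa aniso TYPE('d) * ((gam (fst p) (snd p))\<^sup>2 * (norm (snd p - fst p))\<^sup>2))" for p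
  proof -
    have "(\<lambda>n. H (\<phi> n) p) \<longlonglongrightarrow> (\<Sum>i\<in>UNIV. (Dii aniso \<beta> E (fst p) (snd p) i)\<^sup>2 * a)"
      unfolding H_def by (intro tendsto_intros lim)
    also have "(\<Sum>i\<in>UNIV. (Dii aniso \<beta> E (fst p) (snd p) i)\<^sup>2 * a) = a * (\<Sum>i\<in>UNIV. (Dii aniso \<beta> E (fst p) (snd p) i)\<^sup>2)"
      by (simp add: sum_distrib_left mult.commute)
    finally show ?thesis by (simp only: sum_Dii_sq)
  qed
  show ?thesis
  proof (rule has_integral_dominated_convergence)
    show "(mf_rhs aniso lam \<sigma> \<beta> E f (\<phi> n) has_integral
           ((\<integral>v. \<phi> n v \<partial>M t) - (\<integral>v. \<phi> n v \<partial>M 0))) {0..t}" for n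
      using f_weak[OF test t] t by (simp add: integral_M f_init)
    show "(\<lambda>s. lam * (KG * (1 + 2 * B)) + \<sigma>\<^sup>2 / 2 * (KH * (1 + 2 * B))) integrable_on {0..t}"
      by (rule integrable_const_ivl)
    show "\<forall>s\<in>{0..t}. norm (mf_rhs aniso lam \<sigma> \<beta> E f (\<phi> n) s)
        \<le> lam * (KG * (1 + 2 * B)) + \<sigma>\<^sup>2 / 2 * (KH * (1 + 2 * B))" for n
    proof
      fix s assume s: "s \<in> {0..t}"
      then have s0: "0 \<le> s" by simp
      interpret weighted_L2_distribution "M s" gam "1 / (1 + Cexp)" by (rule weighted_L2_M[OF s0])
      have m: "G (\<phi> n) \<in> borel_measurable (M s \<Otimes>\<^sub>M M s)" "H (\<phi> n) \<in> borel_measurable (M s \<Otimes>\<^sub>M M s)"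
        using G_H_measurable[OF smooth] by (simp_all add: measurable_cong_sets[OF sets_pair_measure_cong[OF sets_M sets_M] refl])
      have B': "1 + 2 * (\<integral>v. (norm v)\<^sup>2 \<partial>M s) \<le> 1 + 2 * B" using B s by simp
      have 1: "\<bar>\<integral>p. G (\<phi> n) p \<partial>(M s \<Otimes>\<^sub>M M s)\<bar> \<le> KG * (1 + 2 * B)"
        by (rule order_trans[OF expectation_pair_le[OF m(1) Gb] mult_left_mono[OF B' KGH(1)]])
      have 2: "\<bar>\<integral>p. H (\<phi> n) p \<partial>(M s \<Otimes>\<^sub>M M s)\<bar> \<le> KH * (1 + 2 * B)"
        by (rule order_trans[OF expectation_pair_le[OF m(2) Hb] mult_left_mono[OF B' KGH(2)]])
      show "norm (mf_rhs aniso lam \<sigma> \<beta> E f (\<phi> n) s)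
        \<le> lam * (KG * (1 + 2 * B)) + \<sigma>\<^sup>2 / 2 * (KH * (1 + 2 * B))"
        unfolding mf_rhs_eq[OF s0 smooth] real_norm_def
        by (rule order_trans[OF abs_triangle_ineq add_mono])
          (auto simp: abs_mult lam_nonneg intro!: mult_left_mono 1 2 divide_right_mono)
    qed
    show "\<forall>s\<in>{0..t}. (\<lambda>n. mf_rhs aniso lam \<sigma> \<beta> E f (\<phi> n) s) \<longlonglongrightarrow> Q a u s"
    proof
      fix s assume s: "s \<in> {0..t}"
      then have s0: "0 \<le> s" by simp
      interpret weighted_L2_distribution "M s" gam "1 / (1 + Cexp)" by (rule weighted_L2_M[OF s0])
      have m: "G (\<phi> n) \<in> borel_measurable (M s \<Otimes>\<^sub>M M s)" "H (\<phi> n) \<in> borel_measurable (M s \<Otimes>\<^sub>M M s)" for n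
        using G_H_measurable[OF smooth] by (simp_all add: measurable_cong_sets[OF sets_pair_measure_cong[OF sets_M sets_M] refl])
      have w: "integrable (M s \<Otimes>\<^sub>M M s) (\<lambda>p. k * (1 + (norm (fst p))\<^sup>2 + (norm (snd p))\<^sup>2))" for k
        by (rule integrable_pair_bound[of _ "\<bar>k\<bar>"]) (auto simp: abs_mult)
      have 1: "(\<lambda>n. \<integral>p. G (\<phi> n) p \<partial>(M s \<Otimes>\<^sub>M M s)) \<longlonglongrightarrow>
          (\<integral>p. gam (fst p) (snd p) * ((a *\<^sub>R fst p + u) \<bullet> (snd p - fst p)) \<partial>(M s \<Otimes>\<^sub>M M s))"
        by (rule integral_dominated_convergence[OF _ m(1) w[of KG]])
          (use Gb Glim in \<open>auto intro!: AE_I2\<close>)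
      have 2: "(\<lambda>n. \<integral>p. H (\<phi> n) p \<partial>(M s \<Otimes>\<^sub>M M s)) \<longlonglongrightarrow>
          (\<integral>p. a * (kappa aniso TYPE('d) * ((gam (fst p) (snd p))\<^sup>2 * (norm (snd p - fst p))\<^sup>2)) \<partial>(M s \<Otimes>\<^sub>M M s))"
        by (rule integral_dominated_convergence[OF _ m(2) w[of KH]])
          (use Hb Hlim in \<open>auto intro!: AE_I2\<close>)
      show "(\<lambda>n. mf_rhs aniso lam \<sigma> \<beta> E f (\<phi> n) s) \<longlonglongrightarrow> Q a u s"
        unfolding mf_rhs_eq[OF s0 smooth] Q_def by (intro tendsto_intros 1 2)
    qed
    have "(\<lambda>n. \<integral>v. \<phi> n v \<partial>M s) \<longlonglongrightarrow> (\<integral>v. quad a u v \<partial>M s)" if "0 \<le> s" for s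
    proof -
      interpret L2_distribution "M s" using that by (rule L2_M)
      show ?thesis
        by (rule integral_dominated_convergence[where w="\<lambda>v. K * (1 + (norm v)\<^sup>2)"])
          (use K(2) lim(1) moment2 in \<open>auto intro!: AE_I2\<close>)
    qed
    then show "(\<lambda>n. (\<integral>v. \<phi> n v \<partial>M t) - (\<integral>v. \<phi> n v \<partial>M 0)) \<longlonglongrightarrow>
        (\<integral>v. quad a u v \<partial>M t) - (\<integral>v. quad a u v \<partial>M 0)"
      using t by (intro tendsto_diff) auto
  qed
qed

lemma integral_quad_M:
  assumes "0 \<le> t"
  shows "(\<integral>v. quad a u v \<partial>M t) = a * (var f t + (norm (mean f t))\<^sup>2 / 2) + u \<bullet> mean f t"
proof -
  interpret L2_distribution "M t" using assms by (rule L2_M)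
  have "(\<integral>v. quad a u v \<partial>M t) = a / 2 * (\<integral>v. (norm v)\<^sup>2 \<partial>M t) + u \<bullet> bary"
    unfolding quad_def bary_def using moment2 by simp
  then show ?thesis
    unfolding second_moment using assms by (simp add: bary_M spread_M algebra_simps)
qed

lemma quad_weak_formulation:
  assumes s: "0 \<le> s" and st: "s \<le> t"
  shows "(Q a u has_integral (a * (var f t + (norm (mean f t))\<^sup>2 / 2) + u \<bullet> mean f t
      - (a * (var f s + (norm (mean f s))\<^sup>2 / 2) + u \<bullet> mean f s))) {s..t}"
proof -
  note I = quad_weak_formulation_from_0[of _ a u]
  have t: "0 \<le> t" using s st by simp
  have 0: "Q a u integrable_on {0..t}" using I[OF t] by blast
  then have "Q a u integrable_on {s..t}" by (rule integrable_subinterval_real) (use s in auto)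
  then have "(Q a u has_integral integral {s..t} (Q a u)) {s..t}" by (rule integrable_integral)
  moreover have "integral {s..t} (Q a u) = integral {0..t} (Q a u) - integral {0..s} (Q a u)"
    using Henstock_Kurzweil_Integration.integral_combine[OF s st 0] by simp
  moreover have "\<dots> = (\<integral>v. quad a u v \<partial>M t) - (\<integral>v. quad a u v \<partial>M s)"
    unfolding integral_unique[OF I[OF t]] integral_unique[OF I[OF s]] by simp
  ultimately show ?thesis by (simp only: integral_quad_M[OF s] integral_quad_M[OF t])
qed

section \<open>Decay of the variance and convergence of the mean\<close>

lemma var_nonneg: "0 \<le> t \<Longrightarrow> 0 \<le> var f t"
  by (simp add: var_def f_nonneg)

lemma Q_mean_bound:
  assumes "0 \<le> t"
  shows "\<bar>Q 0 u t\<bar> \<le> lam * (norm u * sqrt (var f t))"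
proof -
  interpret weighted_L2_distribution "M t" gam "1 / (1 + Cexp)" using assms by (rule weighted_L2_M)
  show ?thesis
    using integral_wt_inner_diff(2)[of u] lam_nonneg assms
    by (simp add: Q_def abs_mult spread_M mult_left_mono)
qed

text \<open>Splits v + u into (v - m) + (m + u). The first part gives the dissipation; the second is
  a constant vector, estimated as for the mean and small when u is close to - m(t). The lower bound
  drops the nonnegative diffusion term.\<close>

lemma Q_var_bounds:
  assumes t: "0 \<le> t"
  shows "Q 1 u t \<le> - \<mu> * var f t + lam * (norm (mean f t + u) * sqrt (var f t))"
    and "- 2 * lam * var f t - lam * (norm (mean f t + u) * sqrt (var f t)) \<le> Q 1 u t"
proof -
  interpret weighted_L2_distribution "M t" gam "1 / (1 + Cexp)" using t by (rule weighted_L2_M)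
  define J where "J = (\<integral>p. gam (fst p) (snd p) * ((fst p - bary) \<bullet> (snd p - fst p)) \<partial>(M t \<Otimes>\<^sub>M M t))"
  define R where "R = (\<integral>p. gam (fst p) (snd p) * ((mean f t + u) \<bullet> (snd p - fst p)) \<partial>(M t \<Otimes>\<^sub>M M t))"
  define D where "D = (\<integral>p. (gam (fst p) (snd p))\<^sup>2 * (norm (snd p - fst p))\<^sup>2 \<partial>(M t \<Otimes>\<^sub>M M t))"
  have "(\<lambda>p. gam (fst p) (snd p) * ((1 *\<^sub>R fst p + u) \<bullet> (snd p - fst p))) =
    (\<lambda>p. gam (fst p) (snd p) * ((fst p - bary) \<bullet> (snd p - fst p)) + gam (fst p) (snd p) * ((mean f t + u) \<bullet> (snd p - fst p)))"
    using t by (auto simp: bary_M distrib_left[symmetric] inner_add_left[symmetric])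
  then have "(\<integral>p. gam (fst p) (snd p) * ((1 *\<^sub>R fst p + u) \<bullet> (snd p - fst p)) \<partial>(M t \<Otimes>\<^sub>M M t)) = J + R"
    unfolding J_def R_def using integral_wt_drift(1) integral_wt_inner_diff(1) by simp
  then have Q: "Q 1 u t = lam * J + lam * R + \<sigma>\<^sup>2 / 2 * kappa aniso TYPE('d) * D"
    by (simp add: Q_def D_def distrib_left)
  have V: "spread = var f t" using t by (rule spread_M)
  have R: "lam * \<bar>R\<bar> \<le> lam * (norm (mean f t + u) * sqrt (var f t))"
    using integral_wt_inner_diff(2)[of "mean f t + u"] lam_nonneg by (intro mult_left_mono) (auto simp: R_def V)
  then have R': "lam * R \<le> lam * (norm (mean f t + u) * sqrt (var f t))"
    "- (lam * (norm (mean f t + u) * sqrt (var f t))) \<le> lam * R"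
    using lam_nonneg abs_le_iff[of "lam * R"] by (auto simp: abs_mult)
  have k: "0 \<le> \<sigma>\<^sup>2 / 2 * kappa aniso TYPE('d)" using kappa_pos[where 'd='d, of aniso] by simp
  have D: "\<sigma>\<^sup>2 / 2 * kappa aniso TYPE('d) * D \<le> \<sigma>\<^sup>2 / 2 * kappa aniso TYPE('d) * (4 * var f t)" "0 \<le> \<sigma>\<^sup>2 / 2 * kappa aniso TYPE('d) * D"
    using mult_left_mono[OF integral_wt_sq_diff_sq(2) k] mult_nonneg_nonneg[OF k integral_wt_sq_diff_sq(1)]
    unfolding D_def V by blast+
  have J: "lam * J \<le> lam * (- 2 * (1 / (1 + Cexp)) * var f t)" "lam * (- 2 * var f t) \<le> lam * J"
    using mult_left_mono[OF integral_wt_drift(2) lam_nonneg] mult_left_mono[OF integral_wt_drift(3) lam_nonneg]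
    unfolding J_def V by blast+
  \<comment> \<open>Converts the lower bound of the weight into the rate that appears in \<mu>,
    using C >= 1.\<close>
  have "1 / Cexp \<le> 2 * (1 / (1 + Cexp))" using Cexp_ge_1 by (simp add: field_simps)
  then have "(1 / Cexp) * (lam * var f t) \<le> 2 * (1 / (1 + Cexp)) * (lam * var f t)"
    using lam_nonneg var_nonneg[OF t] by (intro mult_right_mono) auto
  then have "lam * J \<le> - (lam / Cexp * var f t)" using J(1) by (simp add: mult_ac)
  then show "Q 1 u t \<le> - \<mu> * var f t + lam * (norm (mean f t + u) * sqrt (var f t))"
    unfolding Q \<mu>_def using R'(1) D(1) by (simp add: algebra_simps)
  show "- 2 * lam * var f t - lam * (norm (mean f t + u) * sqrt (var f t)) \<le> Q 1 u t"
    unfolding Q using R'(2) D(2) J(2) by (simp add: algebra_simps)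
qed

lemma mean_increment:
  assumes "0 \<le> s" "s \<le> t"
  shows "(Q 0 u has_integral u \<bullet> (mean f t - mean f s)) {s..t}"
  using quad_weak_formulation[OF assms, of 0 u] by (simp add: inner_diff_right)

text \<open>\<open>mean f\<close> is merely Lipschitz, so \<open>V\<close> is not differentiated. On \<open>[s,t]\<close> one tests with
  \<open>\<bar>v\<bar>\<^sup>2/2 - m(s) \<bullet> v\<close>, with \<open>m(s)\<close> frozen, at the price of errors quadratic in \<open>t - s\<close>.\<close>

lemma var_decay:
  assumes T: "0 \<le> T" and \<mu>: "0 \<le> \<mu>"
  shows "var f T \<le> exp (- \<mu> * T) * var f 0"
proof -
  obtain B where B: "0 \<le> B" "\<And>s. 0 \<le> s \<Longrightarrow> s \<le> T \<Longrightarrow> (\<integral>v. (norm v)\<^sup>2 \<partial>M s) \<le> B"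
    using second_moment_bound[OF T] by blast
  have VB: "var f s \<le> B" if "0 \<le> s" "s \<le> T" for s
  proof -
    interpret L2_distribution "M s" using that(1) by (rule L2_M)
    have "2 * var f s + (norm bary)\<^sup>2 \<le> B"
      using B(2)[OF that] second_moment that(1) by (simp add: spread_M)
    then have "2 * var f s \<le> B" using zero_le_power2[of "norm bary"] by linarith
    then show ?thesis using var_nonneg[OF that(1)] by simp
  qed
  have SB: "sqrt (var f s) \<le> sqrt B" if "0 \<le> s" "s \<le> T" for s using VB[OF that] by simp
  have mean: "norm (mean f t - mean f s) \<le> lam * sqrt B * (t - s)" if st: "0 \<le> s" "s \<le> t" "t \<le> T" for s t
  proof -
    \<comment> \<open>Testing with the increment itself turns the integral into |u|^2, and the bound
      on the integrand is linear in |u|.\<close>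
    define u where "u = mean f t - mean f s"
    have "u \<bullet> u \<le> lam * (norm u * sqrt B) * (t - s)"
    proof (rule has_integral_upper_bound)
      show "(Q 0 u has_integral u \<bullet> u) {s..t}" using mean_increment[OF st(1,2), of u] by (simp add: u_def)
      fix x assume x: "x \<in> {s..t}"
      have "Q 0 u x \<le> lam * (norm u * sqrt (var f x))" using Q_mean_bound[of x u] x st by simp
      also have "\<dots> \<le> lam * (norm u * sqrt B)" using SB[of x] x st lam_nonneg by (intro mult_left_mono) auto
      finally show "Q 0 u x \<le> lam * (norm u * sqrt B)" .
    qed (use st in auto)
    then have "norm u * norm u \<le> norm u * (lam * sqrt B * (t - s))"
      unfolding power2_norm_eq_inner[symmetric] power2_eq_square by (simp only: mult_ac)
    then show ?thesis
      unfolding u_def[symmetric] by (rule le_if_square_le_mult) (use st lam_nonneg B(1) in auto)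
  qed
  \<comment> \<open>L bounds the rate at which the variance can fall: 2 lam B from the drift, one
    lam^2 B T from freezing the mean and another from |m(t) - m(s)|^2 / 2. K collects the
    coefficients of the second-order errors.\<close>
  define L where "L = 2 * lam * B + 2 * (lam\<^sup>2 * B * T)"
  define K where "K = \<mu> * L + lam\<^sup>2 * B"
  have L: "0 \<le> L" "0 \<le> K" using B(1) lam_nonneg T \<mu> by (auto simp: L_def K_def)
  \<comment> \<open>Completing the square: freezing m(s) leaves the extra term |m(t) - m(s)|^2 / 2,
    which is discarded in the upper estimate and bounded in the lower one.\<close>
  have incr: "(Q 1 (- mean f s) has_integral var f t - var f s + (norm (mean f t - mean f s))\<^sup>2 / 2) {s..t}"
    if "0 \<le> s" "s \<le> t" for s t
  proof -
    have "1 * (var f t + (norm (mean f t))\<^sup>2 / 2) + (- mean f s) \<bullet> mean f t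
      - (1 * (var f s + (norm (mean f s))\<^sup>2 / 2) + (- mean f s) \<bullet> mean f s)
      = var f t - var f s + (norm (mean f t - mean f s))\<^sup>2 / 2"
      unfolding power2_norm_eq_inner by (simp add: inner_diff_left inner_diff_right inner_commute field_simps)
    with quad_weak_formulation[OF that, of 1 "- mean f s"] show ?thesis by (simp only:)
  qed
  have err: "lam * (norm (mean f x + - mean f s) * sqrt (var f x)) \<le> lam\<^sup>2 * B * (x - s)"
    if "0 \<le> s" "s \<le> x" "x \<le> T" for s x
  proof -
    have "norm (mean f x - mean f s) * sqrt (var f x) \<le> (lam * sqrt B * (x - s)) * sqrt B"
      using mean[OF that] SB[of x] that lam_nonneg B(1) var_nonneg[of x] by (intro mult_mono) auto
    also have "\<dots> = lam * B * (x - s)" using B(1) real_sqrt_mult_self[of B] by (simp add: algebra_simps)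
    finally have "lam * (norm (mean f x - mean f s) * sqrt (var f x)) \<le> lam * (lam * B * (x - s))"
      using lam_nonneg by (intro mult_left_mono)
    then show ?thesis by (simp add: power2_eq_square mult_ac)
  qed
  \<comment> \<open>The upper bound for the integrand contains - \<mu> V(x); replacing V(x) by V(s)
    requires that V has not fallen much since s.\<close>
  have lower: "var f s - L * (t - s) \<le> var f t" if st: "0 \<le> s" "s \<le> t" "t \<le> T" for s t
  proof -
    have "(- 2 * lam * B - lam\<^sup>2 * B * T) * (t - s) \<le> var f t - var f s + (norm (mean f t - mean f s))\<^sup>2 / 2"
    proof (rule has_integral_lower_bound[OF incr])
      fix x assume x: "x \<in> {s..t}"
      have "lam\<^sup>2 * B * (x - s) \<le> lam\<^sup>2 * B * T" using x st B(1) by (intro mult_left_mono) auto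
      moreover have "lam * var f x \<le> lam * B" using VB[of x] x st lam_nonneg by (intro mult_left_mono) auto
      ultimately show "- 2 * lam * B - lam\<^sup>2 * B * T \<le> Q 1 (- mean f s) x"
        using Q_var_bounds(2)[of x "- mean f s"] err[of s x] x st by simp
    qed (use st in auto)
    moreover have "(norm (mean f t - mean f s))\<^sup>2 / 2 \<le> lam\<^sup>2 * B * T * (t - s)"
    proof -
      have "(norm (mean f t - mean f s))\<^sup>2 \<le> (lam * sqrt B * (t - s))\<^sup>2"
        using mean[OF st] by (intro power_mono) auto
      also have "\<dots> = lam\<^sup>2 * B * (t - s) * (t - s)" using B(1) by (simp add: power_mult_distrib power2_eq_square[of "t - s"])
      also have "\<dots> \<le> lam\<^sup>2 * B * T * (t - s)" using st B(1) by (intro mult_right_mono mult_left_mono) auto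
      finally show ?thesis using zero_le_power2[of "norm (mean f t - mean f s)"] by linarith
    qed
    ultimately show ?thesis by (simp add: L_def algebra_simps)
  qed
  show ?thesis
  proof (rule exponential_decay_if_increments[OF T \<mu> L(2) var_nonneg])
    fix s t assume st: "0 \<le> s" "s \<le> t" "t \<le> T"
    have "var f t - var f s + (norm (mean f t - mean f s))\<^sup>2 / 2 \<le> (- \<mu> * var f s + K * (t - s)) * (t - s)"
    proof (rule has_integral_upper_bound[OF incr])
      fix x assume x: "x \<in> {s..t}"
      have "\<mu> * (var f s - L * (x - s)) \<le> \<mu> * var f x"
        using lower[of s x] x st \<mu> by (intro mult_left_mono) auto
      then have "Q 1 (- mean f s) x \<le> - \<mu> * (var f s - L * (x - s)) + lam\<^sup>2 * B * (x - s)"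
        using Q_var_bounds(1)[of x "- mean f s"] err[of s x] x st by simp
      also have "\<dots> = - \<mu> * var f s + K * (x - s)" by (simp add: K_def algebra_simps)
      also have "\<dots> \<le> - \<mu> * var f s + K * (t - s)" using x L by (simp add: mult_left_mono)
      finally show "Q 1 (- mean f s) x \<le> - \<mu> * var f s + K * (t - s)" .
    qed (use st in auto)
    moreover have "(- \<mu> * var f s + K * (t - s)) * (t - s) = - \<mu> * (t - s) * var f s + K * (t - s)\<^sup>2"
      by (simp add: algebra_simps power2_eq_square)
    ultimately show "var f t - var f s \<le> - \<mu> * (t - s) * var f s + K * (t - s)\<^sup>2"
      using zero_le_power2[of "norm (mean f t - mean f s)"] by linarith
  qed
qed

lemma mean_cauchy:
  assumes \<mu>: "0 < \<mu>" and st: "0 \<le> s" "s \<le> t"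
  shows "norm (mean f t - mean f s) \<le> 2 * lam / \<mu> * sqrt (var f 0) * (exp (- \<mu> * s / 2) - exp (- \<mu> * t / 2))"
proof -
  define u where "u = mean f t - mean f s"
  \<comment> \<open>The square root halves the decay rate of the variance, so k e^(-\<mu> x / 2)
    dominates \<open>Q 0 u x\<close>; its primitive contributes the factor 2 / \<mu>.\<close>
  define k where "k = lam * norm u * sqrt (var f 0)"
  have 1: "((\<lambda>x. k * exp (- \<mu> * x / 2)) has_integral
      (k * (- 2 / \<mu>) * exp (- \<mu> * t / 2) - k * (- 2 / \<mu>) * exp (- \<mu> * s / 2))) {s..t}"
    using \<mu> by (intro fundamental_theorem_of_calculus st)
      (auto intro!: derivative_eq_intros simp: has_real_derivative_iff_has_vector_derivative[symmetric] field_simps)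
  have 2: "(Q 0 u has_integral u \<bullet> u) {s..t}" using mean_increment[OF st, of u] by (simp add: u_def)
  have 3: "Q 0 u x \<le> k * exp (- \<mu> * x / 2)" if "x \<in> {s..t}" for x
  proof -
    have x: "0 \<le> x" using that st by simp
    have "sqrt (var f x) \<le> sqrt (exp (- \<mu> * x) * var f 0)" using var_decay[OF x] \<mu> by simp
    also have "\<dots> = exp (- \<mu> * x / 2) * sqrt (var f 0)"
      by (simp add: real_sqrt_mult real_sqrt_unique power2_eq_square flip: exp_add)
    finally have "lam * (norm u * sqrt (var f x)) \<le> lam * (norm u * (exp (- \<mu> * x / 2) * sqrt (var f 0)))"
      using lam_nonneg by (intro mult_left_mono) auto
    with Q_mean_bound[OF x, of u] show ?thesis by (simp add: k_def mult_ac)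
  qed
  have "u \<bullet> u \<le> k * (- 2 / \<mu>) * exp (- \<mu> * t / 2) - k * (- 2 / \<mu>) * exp (- \<mu> * s / 2)"
    by (rule has_integral_le[OF 2 1 3])
  then have "norm u * norm u \<le> norm u * (2 * lam / \<mu> * sqrt (var f 0) * (exp (- \<mu> * s / 2) - exp (- \<mu> * t / 2)))"
    unfolding power2_norm_eq_inner[symmetric] power2_eq_square by (simp add: k_def algebra_simps)
  moreover have "0 \<le> 2 * lam / \<mu> * sqrt (var f 0) * (exp (- \<mu> * s / 2) - exp (- \<mu> * t / 2))"
    using \<mu> st lam_nonneg var_nonneg[of 0] by (intro mult_nonneg_nonneg) auto
  ultimately show ?thesis
    unfolding u_def[symmetric] by (rule le_if_square_le_mult)
qed

lemma mean_converges:
  assumes \<mu>: "0 < \<mu>"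
  obtains vt where "(mean f \<longlongrightarrow> vt) at_top" "norm (mean f 0 - vt) \<le> 2 * lam / \<mu> * sqrt (var f 0)"
proof -
  define k where "k = 2 * lam / \<mu> * sqrt (var f 0)"
  have k: "0 \<le> k" using \<mu> lam_nonneg var_nonneg[of 0] by (simp add: k_def)
  define e where "e t = k * exp (- \<mu> * t / 2)" for t
  have e0: "(e \<longlongrightarrow> 0) at_top"
  proof -
    have "((\<lambda>t. exp (- \<mu> * t / 2)) \<longlongrightarrow> 0) at_top"
      using \<mu> filterlim_compose[OF exp_at_bot filterlim_tendsto_neg_mult_at_bot[OF tendsto_const[of "- \<mu> / 2"] _ filterlim_ident]]
      by simp
    from tendsto_mult_left[OF this, of k] show ?thesis by (simp add: e_def[abs_def])
  qed
  have le: "norm (mean f t - mean f s) \<le> e s" if st: "0 \<le> s" "s \<le> t" for s t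
  proof -
    have "norm (mean f t - mean f s) \<le> e s - e t"
      using mean_cauchy[OF \<mu> st] by (simp add: k_def e_def algebra_simps)
    also have "\<dots> \<le> e s" using k by (simp add: e_def)
    finally show ?thesis .
  qed
  have en: "(\<lambda>n. e (real n)) \<longlonglongrightarrow> 0"
    by (rule filterlim_compose[OF e0 filterlim_real_sequentially])
  \<comment> \<open>Completeness is used along the integers; the rate \<open>e\<close> then
    transfers the limit to all real times.\<close>
  have "Cauchy (\<lambda>n. mean f (real n))"
  proof (rule metric_CauchyI)
    fix r :: real assume "0 < r"
    then obtain N where N: "\<And>n. N \<le> n \<Longrightarrow> e (real n) < r"
      using order_tendstoD(2)[OF en] by (auto simp: eventually_sequentially)
    have "dist (mean f (real m)) (mean f (real n)) < r" if "N \<le> m" "N \<le> n" for m n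
      using that
    proof (induction m n rule: linorder_wlog)
      case (le m n)
      have "dist (mean f (real m)) (mean f (real n)) \<le> e (real m)"
        using assms \<open>m \<le> n\<close> \<open>\<And>s t. 0 \<le> s \<Longrightarrow> s \<le> t \<Longrightarrow> norm (mean f t - mean f s) \<le> e s\<close>
        by (simp add: dist_norm norm_minus_commute)
      then show ?case using N[of m] le by simp
    qed (simp add: dist_commute)
    then show "\<exists>N. \<forall>m\<ge>N. \<forall>n\<ge>N. dist (mean f (real m)) (mean f (real n)) < r" by blast
  qed
  then obtain vt where vt: "(\<lambda>n. mean f (real n)) \<longlonglongrightarrow> vt"
    using Cauchy_convergent convergent_def by blast
  \<comment> \<open>Letting the later time tend to infinity gives a rate from every s; s = 0 yields
    the second claim.\<close>
  have lim: "norm (mean f s - vt) \<le> e s" if "0 \<le> s" for s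
  proof (rule LIMSEQ_le_const2)
    show "(\<lambda>n. norm (mean f s - mean f (real n))) \<longlonglongrightarrow> norm (mean f s - vt)"
      by (intro tendsto_intros vt)
    have "norm (mean f s - mean f (real n)) \<le> e s" if "nat \<lceil>s\<rceil> \<le> n" for n
      using le[of s "real n"] \<open>0 \<le> s\<close> that by (simp add: norm_minus_commute)
    then show "\<exists>N. \<forall>n\<ge>N. norm (mean f s - mean f (real n)) \<le> e s" by blast
  qed
  have "(mean f \<longlongrightarrow> vt) at_top"
    by (rule Lim_null_comparison[THEN Lim_null[THEN iffD2], OF _ e0])
      (use lim in \<open>auto simp: eventually_at_top_linorder\<close>)
  moreover have "norm (mean f 0 - vt) \<le> k" using lim[of 0] by (simp add: e_def)
  ultimately show ?thesis using that by (simp add: k_def)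
qed

end

section \<open>The objective at the limit of the mean\<close>

theorem theorem1:
  fixes E :: "real^'d::finite \<Rightarrow> real"
    and gradE :: "real^'d \<Rightarrow> real^'d" and HE :: "real^'d \<Rightarrow> real^'d^'d"
    and c1 c2 lam \<sigma> \<beta> :: real
    and aniso :: bool
    and f :: "real^'d \<Rightarrow> real \<Rightarrow> real" and f0 :: "real^'d \<Rightarrow> real"
  assumes C2: "has_grad_hess E gradE HE"
    and pos: "\<forall>v. E v > 0"
    and bdd: "bdd_above (range E)"
    and c1: "c1 > 0" "\<forall>v. norm (gradE v) \<le> c1"
    and c2: "c2 > 0" "\<forall>v i. \<bar>HE v $ i $ i\<bar> \<le> c2"
    and params: "lam \<ge> 0" "\<sigma> \<ge> 0" "\<beta> > 0"
    and sol: "mf_solution aniso lam \<sigma> \<beta> E f f0"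
    and mu_pos: "lam / exp (\<beta> * (Sup (range E) - Inf (range E)))
                   - 2 * \<sigma>\<^sup>2 * kappa aniso TYPE('d) > 0"
    and nu_small: "4 * (lam * c1 + \<sigma>\<^sup>2 * kappa aniso TYPE('d) * c2) * \<beta> * exp (- \<beta> * Inf (range E))
                   / ((lam / exp (\<beta> * (Sup (range E) - Inf (range E)))
                        - 2 * \<sigma>\<^sup>2 * kappa aniso TYPE('d)) * L1w \<beta> E f0)
                   * sqrt (var f 0) < 1/2"
  shows "\<exists>vt. (mean f \<longlongrightarrow> vt) at_top \<and>
           E vt \<le> Inf (range E) + (- (1/\<beta>) * ln (L1w \<beta> E f0) - Inf (range E)) + ln 2 / \<beta>"
proof -
  have E_deriv: "(E has_derivative (\<lambda>h. gradE v \<bullet> h)) (at v)" for v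
    using C2 by (simp add: has_grad_hess_def)
  have bddb: "bdd_below (range E)"
    using pos by (auto intro!: bdd_belowI[of _ 0] less_imp_le)
  have contE: "continuous_on UNIV E"
    using E_deriv has_derivative_continuous by (intro continuous_at_imp_continuous_on) blast
  interpret mean_field E lam \<sigma> \<beta> aniso f f0
    by unfold_locales (fact contE bddb bdd params sol)+
  have \<mu>: "0 < \<mu>" using mu_pos by (simp add: \<mu>_def Cexp_def)
  obtain vt where vt: "(mean f \<longlongrightarrow> vt) at_top" "norm (mean f 0 - vt) \<le> 2 * lam / \<mu> * sqrt (var f 0)"
    using mean_converges[OF \<mu>] .
  interpret L2_distribution "M 0" by (rule L2_M) simp
  define w where "w = omega \<beta> E"
  define e where "e = exp (- \<beta> * Inf (range E))"
  define L where "L = \<beta> * c1 * e"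
  have L: "0 \<le> L" using params c1 by (simp add: L_def e_def)
  have w_le: "w v \<le> e" for v
    using params bddb by (simp add: w_def e_def omega_def cInf_lower)
  have w_pos: "0 < w v" for v by (simp add: w_def omega_pos)
  \<comment> \<open>The gradient of w is - \<beta> w grad E, and w <= e, |grad E| <= c1 bound its
    norm by L.\<close>
  have w_lip: "\<bar>w v - w z\<bar> \<le> L * norm (v - z)" for v z
  proof -
    have "norm (w v - w z) \<le> L * norm (v - z)"
    proof (rule differentiable_bound[where S=UNIV and f'="\<lambda>x h. w x * (- \<beta> * (gradE x \<bullet> h))"])
      show "(w has_derivative (\<lambda>h. w x * (- \<beta> * (gradE x \<bullet> h)))) (at x within UNIV)" for x
        unfolding w_def omega_def[abs_def]
        by (auto intro!: derivative_eq_intros E_deriv)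
      show "onorm (\<lambda>h. w x * (- \<beta> * (gradE x \<bullet> h))) \<le> L" for x
      proof (rule onorm_le)
        fix h
        have "norm (w x * (- \<beta> * (gradE x \<bullet> h))) = w x * (\<beta> * \<bar>gradE x \<bullet> h\<bar>)"
          using w_pos[of x] params by (simp add: abs_mult)
        also have "\<bar>gradE x \<bullet> h\<bar> \<le> c1 * norm h"
          using Cauchy_Schwarz_ineq2[of "gradE x" h] c1(2) by (meson mult_right_mono norm_ge_zero order_trans)
        then have "w x * (\<beta> * \<bar>gradE x \<bullet> h\<bar>) \<le> e * (\<beta> * (c1 * norm h))"
          using w_le[of x] w_pos[of x] params c1 by (intro mult_mono) (auto simp: e_def)
        finally show "norm (w x * (- \<beta> * (gradE x \<bullet> h))) \<le> L * norm h"
          by (simp add: L_def mult_ac)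
      qed
    qed auto
    then show ?thesis by simp
  qed
  have w_meas [measurable]: "w \<in> borel_measurable borel"
    unfolding w_def omega_def[abs_def] by measurable
  have w_int: "integrable (M 0) w"
    by (rule integrable_const_bound[of _ e]) (use w_le w_pos in \<open>auto simp: less_imp_le\<close>)
  define L0 where "L0 = L1w \<beta> E f0"
  have L0_eq: "L0 = (\<integral>v. w v \<partial>M 0)"
    using integral_M[OF order_refl w_meas] by (simp add: L0_def L1w_def f_init mult.commute flip: w_def)
  \<comment> \<open>Allows division by L0: the initial law has mass 1 and w is bounded below through
    the supremum of E.\<close>
  have L0_pos: "0 < L0"
  proof -
    have "exp (- \<beta> * Sup (range E)) \<le> w v" for v
      using params bdd by (simp add: w_def omega_def cSup_upper)
    then have "(\<integral>v. exp (- \<beta> * Sup (range E)) \<partial>M 0) \<le> L0"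
      unfolding L0_eq using w_int by (intro integral_mono) auto
    then show ?thesis by (simp add: prob_space) (meson exp_gt_zero less_le_trans)
  qed
  have "L0 - w vt = (\<integral>v. w v - w vt \<partial>M 0)"
    using w_int by (simp add: L0_eq prob_space)
  also have "\<dots> \<le> (\<integral>v. L * norm (v - vt) \<partial>M 0)"
    using w_int w_lip by (intro integral_mono) (auto simp: abs_le_iff)
  also have "\<dots> \<le> L * (sqrt (2 * var f 0) + norm (mean f 0 - vt))"
    using expectation_dist_le[of vt] L by (simp add: spread_M bary_M mult_left_mono)
  \<comment> \<open>Both summands are brought to the same form, since \<mu> <= lam gives sqrt 2 <= 2
    <= 2 lam / \<mu>. Their sum carries the constant 4 of \<open>nu_small\<close>.\<close>
  also have "\<dots> \<le> L * (2 * lam / \<mu> * sqrt (var f 0) + 2 * lam / \<mu> * sqrt (var f 0))"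
  proof (intro mult_left_mono add_mono vt L)
    have "sqrt 2 \<le> (2::real)" by (rule real_le_lsqrt) auto
    moreover have "1 \<le> lam / \<mu>"
    proof -
      have "0 \<le> 2 * \<sigma>\<^sup>2 * kappa aniso TYPE('d)" using kappa_pos[where 'd='d, of aniso] by simp
      moreover have "lam / Cexp \<le> lam / 1"
        using params Cexp_ge_1 by (intro divide_left_mono) auto
      ultimately have "\<mu> \<le> lam" unfolding \<mu>_def by linarith
      then show ?thesis using \<mu> by simp
    qed
    ultimately have "sqrt 2 * sqrt (var f 0) \<le> 2 * (lam / \<mu>) * sqrt (var f 0)"
      using var_nonneg[of 0] by (intro mult_right_mono) auto
    then show "sqrt (2 * var f 0) \<le> 2 * lam / \<mu> * sqrt (var f 0)" by (simp add: real_sqrt_mult)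
  qed
  \<comment> \<open>Divided by L0, the previous bound is 4 lam c1 \<beta> e sqrt (V(0)) / (\<mu>
    L0), which is at most the quantity \<nu> in \<open>nu_small\<close>.\<close>
  also have "\<dots> \<le> L0 / 2"
  proof -
    have "4 * (lam * c1 + 0) * \<beta> * e / (\<mu> * L0) * sqrt (var f 0) \<le>
      4 * (lam * c1 + \<sigma>\<^sup>2 * kappa aniso TYPE('d) * c2) * \<beta> * e / (\<mu> * L0) * sqrt (var f 0)"
      using \<mu> L0_pos params c1 c2 var_nonneg[of 0] kappa_pos[where 'd='d, of aniso]
      by (intro mult_right_mono divide_right_mono mult_left_mono add_left_mono) (auto simp: e_def)
    also have "\<dots> < 1 / 2"
      using nu_small by (simp add: \<mu>_def Cexp_def e_def L0_def)
    finally show ?thesis using \<mu> L0_pos by (simp add: L_def field_simps)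
  qed
  finally have w_ge: "L0 / 2 \<le> w vt" by simp
  have "ln (L0 / 2) \<le> ln (w vt)" using w_ge L0_pos w_pos by simp
  also have "\<dots> = - \<beta> * E vt" by (simp add: w_def omega_def)
  finally have "\<beta> * E vt \<le> ln 2 - ln L0" using L0_pos by (simp add: ln_div)
  then have "E vt \<le> (ln 2 - ln L0) / \<beta>" using params by (simp add: field_simps)
  \<comment> \<open>Inf (range E) cancels against the one inside r(\<beta>).\<close>
  then have "E vt \<le> Inf (range E) + (- (1/\<beta>) * ln (L1w \<beta> E f0) - Inf (range E)) + ln 2 / \<beta>"
    by (simp add: L0_def diff_divide_distrib)
  with vt(1) show ?thesis by blast
qed

end
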